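(* Let $(d_k)_{k=1}^\infty$ and $(N_k)_{k=1}^\infty$ be sequences of natural numbers such that $(d_k)$ is lacunary, $N_k\mid N_{k+1}$ and $N_k<N_{k+1}$ for all $k$. Put \[A_k=\{(n_1,n_2)\in\mathbb{N}\times\mathbb{N}: n_1+n_2=d_k\},\qquad B_k=\{(n_1,n_2)\in A_k: N_k\mid n_1\},\qquad B=\bigcup_{k=1}^\infty B_k.\] Then the following are equivalent: (i) there exist constants $a,C$ such that $d_k\le C N_{k+a}$ for all $k$; (ii) $B$ belongs to the idempotent ring of $H^1(\mathbb{T}\times\mathbb{T})$, i.e. the operator $T$ defined on trigonometric polynomials in $H^1(\mathbb{T}\times\mathbb{T})$ by $\widehat{Tf}=\mathbbm{1}_B\widehat f$ extends to a bounded operator $H^1(\mathbb{T}\times\mathbb{T})\to H^1(\mathbb{T}\times\mathbb{T})$.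
   Context: $\mathbb{N}=\{0,1,2,\dots\}$. A sequence $(d_k)$ of positive integers is lacunary if $\inf_k d_{k+1}/d_k>1$. $\mathbb{T}=\mathbb{R}/2\pi\mathbb{Z}$ with normalized Lebesgue measure. $H^1(\mathbb{T}\times\mathbb{T})$ is the closed linear span in $L^1(\mathbb{T}^2)$ of the characters $e^{i(n_1t_1+n_2t_2)}$ with $n_1,n_2\ge 0$. The idempotent ring of $H^1(\mathbb{T}\times\mathbb{T})$ is the family of sets $E\subset\mathbb{N}\times\mathbb{N}$ for which the Fourier multiplier $\mathbbm{1}_E$ is bounded on $H^1(\mathbb{T}\times\mathbb{T})$. *)

theory Defs
  imports "HOL-Analysis.Analysis"
begin

definition trig_poly2 :: "(nat \<times> nat \<Rightarrow> complex) \<Rightarrow> real \<Rightarrow> real \<Rightarrow> complex" where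
  "trig_poly2 c s t = (\<Sum>n\<in>{n. c n \<noteq> 0}.
      c n * exp (\<i> * (of_nat (fst n) * of_real s + of_nat (snd n) * of_real t)))"

definition L1_norm_T2 :: "(real \<Rightarrow> real \<Rightarrow> complex) \<Rightarrow> real" where
  "L1_norm_T2 f = integral (cbox (0,0) (2*pi, 2*pi)) (\<lambda>(s,t). cmod (f s t)) / (4 * pi\<^sup>2)"

text \<open>E belongs to the idempotent ring of H^1(T x T): the multiplier 1_E, defined on
  analytic trigonometric polynomials, is bounded in the H^1 (= L^1) norm, hence extends
  to a bounded operator on H^1 (trigonometric polynomials are dense).\<close>

definition idempotent_ring_H1 :: "(nat \<times> nat) set \<Rightarrow> bool" where
  "idempotent_ring_H1 E \<longleftrightarrow> (\<exists>K. \<forall>c. finite {n. c n \<noteq> 0} \<longrightarrow>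
      L1_norm_T2 (trig_poly2 (\<lambda>n. if n \<in> E then c n else 0)) \<le> K * L1_norm_T2 (trig_poly2 c))"

definition lacunary :: "(nat \<Rightarrow> nat) \<Rightarrow> bool" where
  "lacunary d \<longleftrightarrow> (\<forall>k\<ge>1. d k > 0) \<and> (\<exists>q>1. \<forall>k\<ge>1. real (d (k+1)) \<ge> q * real (d k))"

end

theory Submission
  imports Defs
begin

text \<open>The shear \<open>t\<^sub>1 = s + t\<close>, \<open>t\<^sub>2 = t\<close> turns \<open>f\<close> into an analytic polynomial in \<open>t\<close> whose
  \<open>m\<close>-th coefficient is the slice \<open>f\<^sub>m(s) = \<Sum> c(n, m - n) e\<^bsup>\<i> n s\<^esup>\<close>. The inequality of Paley in \<open>t\<close>,
  together with the bound of the \<open>L\<^sup>1\<close> norm by the \<open>L\<^sup>2\<close> norm, replaces \<open>L\<^sup>1\<close> norms by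
  \<open>\<integral> (\<Sum>\<^sub>k |f\<^bsub>d k\<^esub>(s)|\<^sup>2)\<^bsup>1/2\<^esup> ds\<close>, and the multiplier replaces \<open>f\<^bsub>d k\<^esub>\<close> by its average \<open>P\<^sub>k f\<^bsub>d k\<^esub>\<close> over
  translations by multiples of \<open>2\<pi>/N\<^sub>k\<close>.

  Sufficiency: after splitting into residue classes of \<open>k\<close> one may assume that \<open>f\<^sub>k\<close> has degree at
  most \<open>N\<^bsub>k+1\<^esub>\<close>. Let \<open>S\<^sub>k\<close> be the square function of the first \<open>k\<close> terms. Convexity gives
  \<open>P\<^sub>k S\<^bsub>k+1\<^esub> \<ge> ((P\<^sub>k S\<^sub>k)\<^sup>2 + |P\<^sub>k f\<^sub>k|\<^sup>2)\<^bsup>1/2\<^esup>\<close>, so the means of the increments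
  \<open>v\<^sub>k = ((P\<^sub>k S\<^sub>k)\<^sup>2 + |P\<^sub>k f\<^sub>k|\<^sup>2)\<^bsup>1/2\<^esup> - P\<^sub>k S\<^sub>k\<close> telescope; the sampling bound
  \<open>P\<^sub>k S\<^sub>k \<le> 5 \<integral> S\<^sub>k\<close> then controls \<open>|P\<^sub>k f\<^sub>k|\<^sup>2 = v\<^sub>k\<^sup>2 + 2 v\<^sub>k P\<^sub>k S\<^sub>k\<close>.

  Necessity: if \<open>d\<^sub>k > 2 N\<^bsub>k+a\<^esub>\<close>, take one modulated Fejer kernel of order \<open>L = N\<^bsub>k+a\<^esub>\<close> as the
  slices \<open>k, \<dots>, k + a\<close>. The square function of the slices has mean \<open>(a + 1)\<^bsup>1/2\<^esup>\<close>, while that of the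
  averaged kernels, which peak at the multiples of \<open>2\<pi>/N\<^sub>j\<close>, has mean at least \<open>a/10\<close>.\<close>

section \<open>Means over the circle\<close>

definition cmean :: "(real \<Rightarrow> 'a::euclidean_space) \<Rightarrow> 'a" where
  "cmean f = integral {0..2*pi} f /\<^sub>R (2*pi)"

lemma integrable_on_circle:
  fixes f :: "real \<Rightarrow> 'a::euclidean_space"
  shows "continuous_on UNIV f \<Longrightarrow> f integrable_on {a..b}"
  by (meson continuous_on_subset integrable_continuous_interval subset_UNIV)

lemma cmean_const [simp]: "cmean (\<lambda>x. c) = c"
  by (simp add: cmean_def)

lemma cmean_add:
  "continuous_on UNIV f \<Longrightarrow> continuous_on UNIV g \<Longrightarrow> cmean (\<lambda>x. f x + g x) = cmean f + cmean g"
  unfolding cmean_def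
  by (subst Henstock_Kurzweil_Integration.integral_add) (auto intro: integrable_on_circle simp: algebra_simps)

lemma cmean_diff:
  "continuous_on UNIV f \<Longrightarrow> continuous_on UNIV g \<Longrightarrow> cmean (\<lambda>x. f x - g x) = cmean f - cmean g"
  unfolding cmean_def
  by (subst Henstock_Kurzweil_Integration.integral_diff) (auto intro: integrable_on_circle simp: algebra_simps)

lemma cmean_sum:
  "finite I \<Longrightarrow> (\<And>i. i \<in> I \<Longrightarrow> continuous_on UNIV (f i)) \<Longrightarrow>
    cmean (\<lambda>x. \<Sum>i\<in>I. f i x) = (\<Sum>i\<in>I. cmean (f i))"
  unfolding cmean_def
  by (subst Henstock_Kurzweil_Integration.integral_sum)
    (auto intro: integrable_on_circle simp: scaleR_sum_right)

lemma cmean_mult: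
  fixes f :: "real \<Rightarrow> 'a::{euclidean_space,real_normed_field}"
  shows "cmean (\<lambda>x. c * f x) = c * cmean f"
  by (simp add: cmean_def)

lemma cmean_mono:
  fixes f g :: "real \<Rightarrow> real"
  assumes "continuous_on UNIV f" "continuous_on UNIV g" "\<And>x. f x \<le> g x"
  shows "cmean f \<le> cmean g"
  unfolding cmean_def using assms
  by (auto intro!: mult_left_mono Henstock_Kurzweil_Integration.integral_le integrable_on_circle)

lemma cmean_nonneg:
  fixes f :: "real \<Rightarrow> real"
  assumes "continuous_on UNIV f" "\<And>x. 0 \<le> f x"
  shows "0 \<le> cmean f"
  using cmean_mono[of "\<lambda>_. 0" f] assms by simp

lemma norm_cmean_le:
  assumes "continuous_on UNIV f" "continuous_on UNIV g" "\<And>x. norm (f x) \<le> g x"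
  shows "norm (cmean f) \<le> cmean g"
  unfolding cmean_def using assms
  by (auto intro!: mult_left_mono Henstock_Kurzweil_Integration.integral_norm_bound_integral
      integrable_on_circle)

lemma cmean_of_real:
  assumes "continuous_on UNIV f"
  shows "cmean (\<lambda>x. complex_of_real (f x)) = of_real (cmean f)"
proof -
  have "integral {0..2*pi} (complex_of_real \<circ> f) = complex_of_real (integral {0..2*pi} f)"
    by (intro integral_linear integrable_on_circle assms bounded_linear_of_real)
  then show ?thesis by (simp add: cmean_def o_def scaleR_conv_of_real)
qed

lemma periodic_of_int:
  fixes f :: "real \<Rightarrow> 'a" and k :: int
  assumes "\<And>x. f (x + 2*pi) = f x"
  shows "f (x + 2*pi*k) = f x"
proof -
  have *: "f (x + 2*pi*real n) = f x" for n x
  proof (induction n)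
    case (Suc n)
    have "f (x + 2*pi*real (Suc n)) = f ((x + 2*pi*real n) + 2*pi)" by (simp add: algebra_simps)
    then show ?case using assms Suc by metis
  qed auto
  show ?thesis
  proof (cases "k \<ge> 0")
    case True
    then show ?thesis using *[of x "nat k"] by simp
  next
    case False
    then show ?thesis using *[of "x + 2*pi*k" "nat (-k)"] by simp
  qed
qed

text \<open>Only the residue \<open>b\<close> of the shift modulo \<open>2*pi\<close> matters; the
  part of the shifted interval beyond \<open>2*pi\<close> is moved back to \<open>{0..b}\<close> by
  periodicity.\<close>

lemma cmean_shift:
  assumes c: "continuous_on UNIV f" and p: "\<And>x. f (x + 2*pi) = f x"
  shows "cmean (\<lambda>x. f (x + a)) = cmean f"
proof -
  define k where "k = \<lfloor>a / (2*pi)\<rfloor>"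
  define b where "b = a - 2*pi*k"
  have "real_of_int k \<le> a / (2*pi)" "a / (2*pi) < real_of_int k + 1"
    unfolding k_def by linarith+
  then have b: "0 \<le> b" "b \<le> 2*pi" unfolding b_def by (auto simp: field_simps)
  have "f (x + a) = (f \<circ> (+) b) x" for x
    using periodic_of_int[of f "x + b" k, OF p] by (simp add: b_def add.commute)
  then have "integral {0..2*pi} (\<lambda>x. f (x + a)) = integral {0..2*pi} (f \<circ> (+) b)" by presburger
  also have "\<dots> = integral {b..2*pi+b} f" by (simp add: integral_shift_Icc_real)
  also have "\<dots> = integral {b..2*pi} f + integral {2*pi..2*pi+b} f"
    using b by (intro Henstock_Kurzweil_Integration.integral_combine[symmetric] integrable_on_circle c) auto
  also have "integral {2*pi..2*pi+b} f = integral {0..b} (f \<circ> (+) (2*pi))"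
    by (simp add: integral_shift_Icc_real add.commute)
  also have "f \<circ> (+) (2*pi) = f" using p by (auto simp: fun_eq_iff add.commute)
  also have "integral {b..2*pi} f + integral {0..b} f = integral {0..2*pi} f"
    using b by (subst add.commute, intro Henstock_Kurzweil_Integration.integral_combine integrable_on_circle c) auto
  finally show ?thesis by (simp add: cmean_def)
qed

lemma continuous_on_cmean:
  assumes "continuous_on UNIV (\<lambda>(x,y). f x y)"
  shows "continuous_on UNIV (\<lambda>x. cmean (f x))"
  unfolding cmean_def
  using integral_continuous_on_param[of UNIV 0 "2*pi" f] assms
  by (intro continuous_intros) (auto intro: continuous_on_subset)

lemma cmean_swap:
  fixes f :: "real \<Rightarrow> real \<Rightarrow> 'a::euclidean_space"
  assumes "continuous_on UNIV (\<lambda>(x,y). f x y)"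
  shows "cmean (\<lambda>x. cmean (f x)) = cmean (\<lambda>y. cmean (\<lambda>x. f x y))"
  using integral_swap_continuous[of 0 0 "2*pi" "2*pi" f, OF continuous_on_subset[OF assms]]
  by (simp add: cmean_def)

lemma cis_int_periodic [simp]: "cis (of_int m * (x + 2*pi)) = cis (of_int m * x)"
proof -
  have "cis (of_int m * (x + 2*pi)) = cis (of_int m * x) * cis (2 * pi * of_int m)"
    by (simp add: cis_mult algebra_simps)
  then show ?thesis by (simp add: cis_multiple_2pi)
qed

lemma cmean_cis: "cmean (\<lambda>x. cis (of_int m * x)) = (if m = 0 then 1 else 0)"
proof (cases "m = 0")
  case False
  have "((\<lambda>x. cis (of_int m * x)) has_integral
      cis (of_int m * (2*pi)) / (\<i> * of_int m) - cis (of_int m * 0) / (\<i> * of_int m)) {0..2*pi}"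
    using False
    by (intro fundamental_theorem_of_calculus)
      (auto simp: cis_conv_exp field_simps intro!: derivative_eq_intros has_vector_derivative_real_field)
  moreover have "cis (of_int m * (2*pi)) = 1" using cis_int_periodic[of m 0] by simp
  ultimately show ?thesis using False by (simp add: cmean_def integral_unique)
qed simp

lemma continuous_on_L2_set [continuous_intros]:
  assumes "\<And>i. i \<in> A \<Longrightarrow> continuous_on S (f i)"
  shows "continuous_on S (\<lambda>x. L2_set (\<lambda>i. f i x) A)"
  unfolding L2_set_def using assms by (auto intro!: continuous_intros)

section \<open>Fejer kernels and grid averages\<close>

definition fejer :: "nat \<Rightarrow> real \<Rightarrow> real" where
  "fejer n x = (cmod (\<Sum>j<n. cis (real j * x)))\<^sup>2 / real n"

definition fejer_coeff :: "nat \<Rightarrow> int \<Rightarrow> real" where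
  "fejer_coeff n m = max 0 (1 - \<bar>real_of_int m\<bar> / real n)"

lemma fejer_nonneg [simp]: "0 \<le> fejer n x"
  by (simp add: fejer_def)

lemma continuous_on_fejer [continuous_intros]:
  "continuous_on S f \<Longrightarrow> continuous_on S (\<lambda>x. fejer n (f x))"
  unfolding fejer_def by (cases "n = 0") (auto intro!: continuous_intros)

lemma card_int_diff_eq:
  "card {(j,l). j < n \<and> l < n \<and> int j - int l = m} = nat (int n - \<bar>m\<bar>)"
proof (cases "m \<ge> 0")
  case True
  have "{(j,l). j < n \<and> l < n \<and> int j - int l = m} = (\<lambda>l. (l + nat m, l)) ` {..<n - nat m}"
    using True by (auto simp: image_iff)
  then have "card {(j,l). j < n \<and> l < n \<and> int j - int l = m} = n - nat m"
    by (simp add: card_image inj_on_def)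
  then show ?thesis using True by simp
next
  case False
  have "{(j,l). j < n \<and> l < n \<and> int j - int l = m} = (\<lambda>j. (j, j + nat (-m))) ` {..<n - nat (-m)}"
    using False by (auto simp: image_iff)
  then have "card {(j,l). j < n \<and> l < n \<and> int j - int l = m} = n - nat (-m)"
    by (simp add: card_image inj_on_def)
  then show ?thesis using False by simp
qed

text \<open>Expanding the squared modulus gives a sum over pairs \<open>(j, l)\<close>, grouped here
  by \<open>j - l = m\<close>; there are \<open>n - \<bar>m\<bar>\<close> such pairs. The end terms
  \<open>m = n\<close> and \<open>m = - n\<close> have coefficient zero.\<close>

lemma fejer_expand:
  assumes "n > 0"
  shows "complex_of_real (fejer n x)
    = (\<Sum>m\<in>{-int n..int n}. of_real (fejer_coeff n m) * cis (of_int m * x))"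
proof -
  let ?S = "{..<n} \<times> {..<n}"
  have "complex_of_real (real n * fejer n x)
      = (\<Sum>j<n. cis (real j * x)) * cnj (\<Sum>l<n. cis (real l * x))"
    using assms by (simp add: fejer_def complex_norm_square del: of_real_power cnj_sum)
  also have "\<dots> = (\<Sum>p\<in>?S. cis (real_of_int (int (fst p) - int (snd p)) * x))"
    by (simp add: sum_product sum.cartesian_product cis_cnj cis_mult algebra_simps split_def)
  also have "\<dots> = (\<Sum>m\<in>{-int n..int n}. \<Sum>p\<in>{p\<in>?S. int (fst p) - int (snd p) = m}.
      cis (real_of_int (int (fst p) - int (snd p)) * x))"
    by (rule sum.group[symmetric]) auto
  also have "\<dots> = (\<Sum>m\<in>{-int n..int n}. of_real (real n * fejer_coeff n m) * cis (of_int m * x))"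
  proof (rule sum.cong[OF refl])
    fix m assume m: "m \<in> {-int n..int n}"
    have "{p\<in>?S. int (fst p) - int (snd p) = m} = {(j,l). j < n \<and> l < n \<and> int j - int l = m}"
      by auto
    then have "card {p\<in>?S. int (fst p) - int (snd p) = m} = nat (int n - \<bar>m\<bar>)"
      by (simp only: card_int_diff_eq)
    moreover have "real (nat (int n - \<bar>m\<bar>)) = real n * fejer_coeff n m"
    proof -
      have "\<bar>m\<bar> \<le> int n" using m by auto
      then have "\<bar>real_of_int m\<bar> \<le> real n" "real (nat (int n - \<bar>m\<bar>)) = real n - \<bar>real_of_int m\<bar>"
        by linarith+
      then show ?thesis using assms by (simp add: fejer_coeff_def max_def field_simps)
    qed
    ultimately have "complex_of_nat (card {p\<in>?S. int (fst p) - int (snd p) = m})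
        = of_real (real n * fejer_coeff n m)"
      by (metis of_real_of_nat_eq)
    then show "(\<Sum>p\<in>{p\<in>?S. int (fst p) - int (snd p) = m}.
      cis (real_of_int (int (fst p) - int (snd p)) * x))
      = of_real (real n * fejer_coeff n m) * cis (of_int m * x)"
      by simp
  qed
  also have "\<dots> = of_real (real n) * (\<Sum>m\<in>{-int n..int n}. of_real (fejer_coeff n m) * cis (of_int m * x))"
    by (simp add: sum_distrib_left algebra_simps)
  finally show ?thesis using assms by simp
qed

text \<open>A kernel modulated to frequency \<open>k\<close> acts as a Fourier multiplier, a
  triangle centred at \<open>k\<close>. The cases \<open>k = 0\<close>, \<open>d\<close> and
  \<open>- d\<close> drive the inequality of Paley, the case \<open>k = 0\<close> also the
  reproducing formula.\<close>

lemma fejer_convolution: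
  assumes "n > 0"
  shows "cmean (\<lambda>y. cis (of_int m * y) * (of_real (fejer n (x - y)) * cis (of_int k * (x - y))))
    = of_real (fejer_coeff n (m - k)) * cis (of_int m * x)"
proof -
  let ?I = "{-int n..int n}"
  have *: "cis A * ((c * cis B) * cis C) = (c * cis D) * cis E" if "A + B + C = D + E"
    for A B C D E :: real and c
  proof -
    have "cis A * ((c * cis B) * cis C) = c * (cis A * cis B * cis C)" by (simp add: mult_ac)
    also have "\<dots> = (c * cis D) * cis E" by (simp only: cis_mult that mult.assoc)
    finally show ?thesis .
  qed
  have "cmean (\<lambda>y. cis (of_int m * y) * (of_real (fejer n (x - y)) * cis (of_int k * (x - y))))
    = cmean (\<lambda>y. \<Sum>j\<in>?I. (of_real (fejer_coeff n j) * cis (of_int (j + k) * x))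
        * cis (of_int (m - k - j) * y))"
    unfolding fejer_expand[OF assms] sum_distrib_left sum_distrib_right
    by (intro arg_cong[where f=cmean] ext sum.cong refl *) (simp add: algebra_simps)
  also have "\<dots> = (\<Sum>j\<in>?I. (of_real (fejer_coeff n j) * cis (of_int (j + k) * x))
      * (if j = m - k then 1 else 0))"
    by (subst cmean_sum) (auto intro!: continuous_intros sum.cong simp: cmean_mult cmean_cis simp del: of_int_diff)
  also have "\<dots> = (if m - k \<in> ?I then of_real (fejer_coeff n (m - k)) * cis (of_int m * x) else 0)"
    by (simp add: if_distrib[of "(*) _"] sum.delta cong: if_cong)
  also have "\<dots> = of_real (fejer_coeff n (m - k)) * cis (of_int m * x)"
    using assms by (auto simp: fejer_coeff_def max_def field_simps)
  finally show ?thesis .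
qed

lemma cmean_fejer:
  assumes "n > 0" shows "cmean (\<lambda>x. fejer n (x + a)) = 1"
proof -
  have per: "fejer n (x + 2*pi) = fejer n x" for x
    using cis_int_periodic[of "int _" x] by (simp add: fejer_def)
  have "complex_of_real (cmean (fejer n)) = cmean (\<lambda>y. complex_of_real (fejer n y))"
    by (subst cmean_of_real) (auto intro!: continuous_intros)
  also have "\<dots> = (\<Sum>m\<in>{-int n..int n}. of_real (fejer_coeff n m) * (if m = 0 then 1 else 0))"
    unfolding fejer_expand[OF assms]
    by (subst cmean_sum) (auto intro!: continuous_intros sum.cong simp: cmean_mult cmean_cis)
  also have "\<dots> = 1" by (simp add: if_distrib[of "(*) _"] sum.delta fejer_coeff_def cong: if_cong)
  finally have "cmean (fejer n) = 1" by (simp del: of_real_sum)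
  then show ?thesis using cmean_shift[of "fejer n" a] per continuous_on_fejer[OF continuous_on_id] by simp
qed

text \<open>The exponential sum of length \<open>2*n\<close> is that of length \<open>n\<close>
  times \<open>1 + cis (real n * x)\<close>, whose modulus is at most 2: squaring gives 4, and the
  normalisation halves it.\<close>

lemma fejer_double_le: "fejer (2*n) x \<le> 2 * fejer n x"
proof -
  have "(\<Sum>j<2*n. cis (real j * x)) = (\<Sum>j<n. cis (real j * x)) + (\<Sum>j<n. cis (real (j + n) * x))"
    using sum.nat_group[of "\<lambda>j. cis (real j * x)" n 2]
      sum.shift_bounds_nat_ivl[of "\<lambda>j. cis (real j * x)" 0 n n]
    by (simp add: numeral_2_eq_2 lessThan_Suc lessThan_atLeast0 mult.commute algebra_simps)
  also have "\<dots> = (\<Sum>j<n. cis (real j * x)) * (1 + cis (real n * x))"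
    by (simp add: sum_distrib_right distrib_left cis_mult distrib_right)
  finally have "cmod (\<Sum>j<2*n. cis (real j * x)) \<le> cmod (\<Sum>j<n. cis (real j * x)) * 2"
    using norm_triangle_ineq[of 1 "cis (real n * x)"]
    by (simp add: norm_mult mult_left_mono)
  then have "(cmod (\<Sum>j<2*n. cis (real j * x)))\<^sup>2 \<le> (cmod (\<Sum>j<n. cis (real j * x)) * 2)\<^sup>2"
    by (rule power_mono) simp
  then show ?thesis by (cases "n = 0") (auto simp: fejer_def field_simps)
qed

text \<open>The projection onto frequencies divisible by \<open>N\<close> (see
  \<open>grid_mean_cis\<close>), written as an average over translates: in this form it also acts on
  square functions, preserves order and obeys the triangle inequality.\<close>

definition grid_mean :: "nat \<Rightarrow> (real \<Rightarrow> 'a::real_vector) \<Rightarrow> real \<Rightarrow> 'a" where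
  "grid_mean N f x = (\<Sum>l<N. f (x + 2*pi*real l/real N)) /\<^sub>R real N"

text \<open>A geometric sum in \<open>z\<close>, an \<open>N\<close>-th root of unity that equals 1
  exactly when \<open>N\<close> divides \<open>m\<close>.\<close>

lemma grid_mean_cis:
  assumes "N > 0"
  shows "grid_mean N (\<lambda>x. cis (of_int m * x)) x = (if int N dvd m then cis (of_int m * x) else 0)"
proof -
  define z where "z = cis (2*pi * of_int m/real N)"
  have "(\<Sum>l<N. cis (of_int m * (x + 2*pi*real l/real N))) = cis (of_int m * x) * (\<Sum>l<N. z ^ l)"
  proof -
    have "cis (of_int m * (x + 2*pi*real l/real N)) = cis (of_int m * x) * z ^ l" for l
      unfolding z_def Complex.DeMoivre cis_mult by (rule arg_cong[where f=cis]) (simp add: field_simps)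
    then show ?thesis by (simp add: sum_distrib_left)
  qed
  moreover have "(\<Sum>l<N. z ^ l) = (if int N dvd m then of_nat N else 0)"
  proof (cases "int N dvd m")
    case True
    then obtain k where "m = int N * k" by blast
    then have "z = 1" using assms cis_multiple_2pi[of "of_int k"] by (simp add: z_def mult.assoc)
    then show ?thesis using True by simp
  next
    case False
    have "z \<noteq> 1"
    proof
      assume "z = 1"
      then have "cos (2*pi * of_int m/real N) = 1" by (simp add: z_def complex_eq_iff)
      then obtain k :: int where "2*pi * of_int m/real N = of_int k * 2 * pi"
        using cos_one_2pi_int by blast
      then have "real_of_int m = of_int (k * int N)" using assms by (simp add: field_simps)
      then have "m = k * int N" by linarith
      then show False using False by simp
    qed
    moreover have "z ^ N = 1" using assms
      by (simp add: z_def Complex.DeMoivre cis_multiple_2pi)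
    ultimately show ?thesis using False geometric_sum[of z N] by simp
  qed
  ultimately show ?thesis using assms by (simp add: grid_mean_def scaleR_conv_of_real)
qed

lemma grid_mean_sum:
  "grid_mean N (\<lambda>x. \<Sum>i\<in>I. f i x) x = (\<Sum>i\<in>I. grid_mean N (f i) x)"
  unfolding grid_mean_def by (subst sum.swap) (simp add: scaleR_sum_right)

lemma grid_mean_mult:
  fixes f :: "real \<Rightarrow> 'a::real_algebra"
  shows "grid_mean N (\<lambda>x. c * f x) x = c * grid_mean N f x"
  unfolding grid_mean_def by (simp add: sum_distrib_left)

lemma grid_mean_mono:
  fixes f g :: "real \<Rightarrow> real"
  shows "(\<And>x. f x \<le> g x) \<Longrightarrow> grid_mean N f x \<le> grid_mean N g x"
  unfolding grid_mean_def by (auto intro!: mult_left_mono sum_mono)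

lemma norm_grid_mean_le: "norm (grid_mean N f x) \<le> grid_mean N (\<lambda>x. norm (f x)) x"
  unfolding grid_mean_def by (auto intro!: mult_left_mono norm_sum)

lemma continuous_on_grid_mean:
  fixes f :: "real \<Rightarrow> 'a::real_normed_vector"
  assumes "continuous_on UNIV f" shows "continuous_on UNIV (grid_mean N f)"
proof -
  have "continuous_on UNIV (\<lambda>x. f (x + a))" for a
    by (rule continuous_on_compose2[OF assms]) (auto intro!: continuous_intros)
  then show ?thesis unfolding grid_mean_def by (intro continuous_intros)
qed

lemma cmean_grid_mean:
  assumes "continuous_on UNIV f" "\<And>x. f (x + 2*pi) = f x" "N > 0"
  shows "cmean (grid_mean N f) = cmean f"
proof -
  have c: "continuous_on UNIV (\<lambda>x. f (x + a))" for a
    by (rule continuous_on_compose2[OF assms(1)]) (auto intro!: continuous_intros)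
  have "cmean (grid_mean N f) = (\<Sum>l<N. cmean (\<lambda>x. f (x + 2*pi*real l/real N))) /\<^sub>R real N"
    unfolding grid_mean_def cmean_def using c
    by (simp add: Henstock_Kurzweil_Integration.integral_sum integrable_on_circle flip: scaleR_sum_right)
  also have "\<dots> = cmean f" using assms by (simp add: cmean_shift sum_constant_scaleR)
  finally show ?thesis .
qed

text \<open>Among the frequencies from \<open>- M\<close> to \<open>M\<close> only \<open>0\<close>,
  \<open>M\<close> and \<open>- M\<close> survive the averaging, and the last two carry coefficient
  zero. Up to the factor \<open>M\<close>, the translates of the kernel thus form a partition of
  unity.\<close>

lemma grid_mean_fejer:
  assumes "M > 0" shows "grid_mean M (fejer M) x = 1"
proof -
  have "complex_of_real (grid_mean M (fejer M) x) = grid_mean M (\<lambda>x. complex_of_real (fejer M x)) x"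
    by (simp add: grid_mean_def scaleR_conv_of_real)
  also have "\<dots> = (\<Sum>m\<in>{-int M..int M}. of_real (fejer_coeff M m) *
      (if int M dvd m then cis (of_int m * x) else 0))"
    unfolding fejer_expand[OF assms] by (simp add: grid_mean_sum grid_mean_mult grid_mean_cis assms)
  also have "\<dots> = (\<Sum>m\<in>{-int M..int M}. if m = 0 then 1 else 0)"
  proof (rule sum.cong[OF refl])
    fix m assume m: "m \<in> {-int M..int M}"
    show "of_real (fejer_coeff M m) * (if int M dvd m then cis (of_int m * x) else 0)
        = (if m = 0 then 1 else (0::complex))"
    proof (cases "m \<noteq> 0 \<and> int M dvd m")
      case True
      then have "\<bar>m\<bar> = int M" using dvd_imp_le_int[of m "int M"] m by auto
      then have "\<bar>real_of_int m\<bar> = real M" by linarith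
      then show ?thesis using True assms by (simp add: fejer_coeff_def)
    qed (auto simp: fejer_coeff_def)
  qed
  finally show ?thesis by (simp del: of_real_sum)
qed

section \<open>Sampling trigonometric polynomials\<close>

definition bandlimited :: "nat \<Rightarrow> (real \<Rightarrow> complex) \<Rightarrow> bool" where
  "bandlimited M f \<longleftrightarrow> (\<exists>a. f = (\<lambda>x. \<Sum>m\<in>{-int M..int M}. a m * cis (of_int m * x)))"

lemma bandlimited_cis:
  assumes "\<bar>m\<bar> \<le> int M" shows "bandlimited M (\<lambda>x. cis (of_int m * x))"
  unfolding bandlimited_def
proof (intro exI ext)
  fix x
  have "m \<in> {-int M..int M}" using assms by auto
  then show "cis (of_int m * x) = (\<Sum>k\<in>{-int M..int M}. (if k = m then 1 else 0) * cis (of_int k * x))"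
    by (simp add: if_distrib[of "\<lambda>c. c * _"] sum.delta cong: if_cong)
qed

lemma bandlimited_mult:
  assumes "bandlimited M f" shows "bandlimited M (\<lambda>x. c * f x)"
proof -
  obtain a where "f = (\<lambda>x. \<Sum>m\<in>{-int M..int M}. a m * cis (of_int m * x))"
    using assms unfolding bandlimited_def by blast
  then have "(\<lambda>x. c * f x) = (\<lambda>x. \<Sum>m\<in>{-int M..int M}. (c * a m) * cis (of_int m * x))"
    by (simp add: sum_distrib_left mult.assoc)
  then show ?thesis unfolding bandlimited_def by (intro exI)
qed

lemma bandlimited_sum:
  assumes "\<And>i. i \<in> I \<Longrightarrow> bandlimited M (f i)" shows "bandlimited M (\<lambda>x. \<Sum>i\<in>I. f i x)"
proof -
  obtain a where a: "\<And>i. i \<in> I \<Longrightarrow> f i = (\<lambda>x. \<Sum>m\<in>{-int M..int M}. a i m * cis (of_int m * x))"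
    using assms unfolding bandlimited_def by metis
  have "(\<lambda>x. \<Sum>i\<in>I. f i x)
      = (\<lambda>x. \<Sum>m\<in>{-int M..int M}. (\<Sum>i\<in>I. a i m) * cis (of_int m * x))"
    by (simp add: a sum_distrib_right) (subst sum.swap, rule refl)
  then show ?thesis unfolding bandlimited_def by (intro exI)
qed

lemma bandlimited_mono:
  assumes "bandlimited M f" "M \<le> M'" shows "bandlimited M' f"
proof -
  obtain a where a: "f = (\<lambda>x. \<Sum>m\<in>{-int M..int M}. a m * cis (of_int m * x))"
    using assms unfolding bandlimited_def by blast
  show ?thesis unfolding a using assms(2)
    by (intro bandlimited_sum bandlimited_mult bandlimited_cis) auto
qed

lemma bandlimited_continuous: "bandlimited M f \<Longrightarrow> continuous_on UNIV f"
  unfolding bandlimited_def by (auto intro!: continuous_intros)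

lemma bandlimited_periodic: "bandlimited M f \<Longrightarrow> f (x + 2*pi) = f x"
  unfolding bandlimited_def by auto

text \<open>\<open>2 * fejer (2*M) - fejer M\<close> is the de la Vallee Poussin kernel, whose
  Fourier coefficients equal 1 at all frequencies up to \<open>M\<close>; convolution with it fixes
  \<open>f\<close>.\<close>

lemma bandlimited_reproducing:
  assumes "bandlimited M f" "M > 0"
  shows "f x = cmean (\<lambda>y. f y * of_real (2 * fejer (2*M) (x - y) - fejer M (x - y)))"
proof -
  let ?I = "{-int M..int M}"
  obtain a where f: "f = (\<lambda>x. \<Sum>m\<in>?I. a m * cis (of_int m * x))"
    using assms unfolding bandlimited_def by blast
  have *: "cmean (\<lambda>y. cis (of_int m * y) * of_real (fejer n (x - y)))
      = of_real (fejer_coeff n m) * cis (of_int m * x)" if "n > 0" for n m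
    using fejer_convolution[OF that, of m x 0] by simp
  have **: "cmean (\<lambda>y. 2 * (cis (of_int m * y) * of_real (fejer (2*M) (x - y)))
        - cis (of_int m * y) * of_real (fejer M (x - y)))
      = 2 * (of_real (fejer_coeff (2*M) m) * cis (of_int m * x))
      - of_real (fejer_coeff M m) * cis (of_int m * x)" for m
    using assms(2) by (subst cmean_diff) (auto intro!: continuous_intros simp: cmean_mult *)
  have "cmean (\<lambda>y. f y * of_real (2 * fejer (2*M) (x - y) - fejer M (x - y)))
    = cmean (\<lambda>y. \<Sum>m\<in>?I. a m * (2 * (cis (of_int m * y) * of_real (fejer (2*M) (x - y)))
        - cis (of_int m * y) * of_real (fejer M (x - y))))"
    unfolding f sum_distrib_right
    by (intro arg_cong[where f=cmean] ext sum.cong refl) (simp add: algebra_simps)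
  also have "\<dots> = (\<Sum>m\<in>?I. a m * (2 * (of_real (fejer_coeff (2*M) m) * cis (of_int m * x))
      - of_real (fejer_coeff M m) * cis (of_int m * x)))"
    by (subst cmean_sum) (auto intro!: continuous_intros simp: cmean_mult **)
  also have "\<dots> = (\<Sum>m\<in>?I. a m * (of_real (2 * fejer_coeff (2*M) m - fejer_coeff M m) * cis (of_int m * x)))"
    by (simp add: algebra_simps)
  also have "\<dots> = f x" unfolding f
  proof (rule sum.cong[OF refl])
    fix m assume "m \<in> ?I"
    then have "\<bar>m\<bar> \<le> int M" by auto
    then have "\<bar>real_of_int m\<bar> \<le> real M" by linarith
    then have "2 * fejer_coeff (2*M) m - fejer_coeff M m = 1"
      using assms(2) by (auto simp: fejer_coeff_def max_def field_simps)
    then show "a m * (of_real (2 * fejer_coeff (2*M) m - fejer_coeff M m) * cis (of_int m * x))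
      = a m * cis (of_int m * x)" by simp
  qed
  finally show ?thesis by simp
qed

text \<open>The reproducing kernel is at most \<open>5 * fejer M\<close> in modulus, where
  \<open>5 = 2 * 2 + 1\<close> by \<open>fejer_double_le\<close>. A general majorant
  \<open>S\<close> is allowed in order to reach square functions next.\<close>

lemma bandlimited_le_fejer_mean:
  assumes "bandlimited M f" "M > 0" "continuous_on UNIV S" "\<And>y. cmod (f y) \<le> S y"
  shows "cmod (f x) \<le> 5 * cmean (\<lambda>y. S y * fejer M (x - y))"
proof -
  have "cmod (f x) \<le> cmean (\<lambda>y. 5 * (S y * fejer M (x - y)))"
    unfolding bandlimited_reproducing[OF assms(1,2), of x]
  proof (rule norm_cmean_le)
    fix y
    have "\<bar>2 * fejer (2*M) (x - y) - fejer M (x - y)\<bar> \<le> 5 * fejer M (x - y)"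
      using fejer_double_le[of M "x - y"] fejer_nonneg[of M "x - y"] fejer_nonneg[of "2*M" "x - y"]
      by linarith
    moreover have "0 \<le> S y" using assms(4)[of y] norm_ge_zero order_trans by blast
    ultimately have "cmod (f y) * \<bar>2 * fejer (2*M) (x - y) - fejer M (x - y)\<bar>
        \<le> S y * (5 * fejer M (x - y))"
      using assms(4)[of y] by (intro mult_mono) auto
    then show "norm (f y * of_real (2 * fejer (2*M) (x - y) - fejer M (x - y)))
        \<le> 5 * (S y * fejer M (x - y))"
      by (simp only: norm_mult norm_of_real mult.left_commute)
  qed (use assms bandlimited_continuous in \<open>auto intro!: continuous_intros\<close>)
  then show ?thesis by (simp add: cmean_mult)
qed

text \<open>A square function is in general not bandlimited, so the scalar bound is applied to a
  combination \<open>g\<close> of the \<open>f i\<close> that is dominated by \<open>S\<close>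
  (Cauchy-Schwarz) and equals \<open>S\<close> at the given point.\<close>

lemma L2_set_le_fejer_mean:
  assumes "finite A" "\<And>i. i \<in> A \<Longrightarrow> bandlimited M (f i)" "M > 0"
  defines "S \<equiv> \<lambda>x. L2_set (\<lambda>i. cmod (f i x)) A"
  shows "S x \<le> 5 * cmean (\<lambda>y. S y * fejer M (x - y))"
proof -
  have cS: "continuous_on UNIV S" unfolding S_def
    using assms(2) bandlimited_continuous by (auto intro!: continuous_intros)
  have S0: "0 \<le> S y" for y by (simp add: S_def)
  show ?thesis
  proof (cases "S x = 0")
    case True
    have "0 \<le> cmean (\<lambda>y. S y * fejer M (x - y))"
      using cS S0 by (intro cmean_nonneg) (auto intro!: continuous_intros)
    then show ?thesis using True by simp
  next
    case False
    \<comment> \<open>Test against the unit vector in the direction of the value at \<open>x\<close>.\<close>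
    define u where "u i = cnj (f i x) / of_real (S x)" for i
    define g where "g y = (\<Sum>i\<in>A. u i * f i y)" for y
    have S2: "(S y)\<^sup>2 = (\<Sum>i\<in>A. (cmod (f i y))\<^sup>2)" for y
      by (simp add: S_def L2_set_def sum_nonneg)
    have "L2_set (\<lambda>i. cmod (u i)) A = L2_set (\<lambda>i. cmod (f i x) * (1 / S x)) A"
      using S0[of x] by (simp add: u_def norm_divide)
    also have "\<dots> = S x * (1 / S x)"
      using S0[of x] unfolding S_def by (subst L2_set_left_distrib) auto
    finally have u1: "L2_set (\<lambda>i. cmod (u i)) A = 1" using False by simp
    have bg: "bandlimited M g" unfolding g_def
      by (intro bandlimited_sum bandlimited_mult assms(2))
    have gS: "cmod (g y) \<le> S y" for y
    proof -
      have "cmod (g y) \<le> (\<Sum>i\<in>A. \<bar>cmod (u i)\<bar> * \<bar>cmod (f i y)\<bar>)"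
        unfolding g_def by (rule order_trans[OF norm_sum]) (simp add: norm_mult)
      also have "\<dots> \<le> L2_set (\<lambda>i. cmod (u i)) A * S y"
        unfolding S_def by (rule L2_set_mult_ineq)
      finally show ?thesis by (simp add: u1)
    qed
    have "g x = (\<Sum>i\<in>A. of_real ((cmod (f i x))\<^sup>2)) / S x"
      by (simp add: g_def u_def sum_divide_distrib complex_norm_square mult.commute del: of_real_power)
    also have "\<dots> = of_real (S x)"
      unfolding of_real_sum[symmetric] S2[symmetric] using False by (simp add: power2_eq_square)
    finally have "cmod (g x) = S x" using S0[of x] by simp
    then show ?thesis
      using bandlimited_le_fejer_mean[OF bg assms(3) cS gS, of x] by simp
  qed
qed

text \<open>A sampling inequality: averaging the previous pointwise bound over the grid replaces the
  Fejer kernel by the constant 1, so the bound is uniform in \<open>x\<close>.\<close>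

lemma grid_mean_L2_set_le:
  assumes "finite A" "\<And>i. i \<in> A \<Longrightarrow> bandlimited M (f i)" "M > 0"
  shows "grid_mean M (\<lambda>x. L2_set (\<lambda>i. cmod (f i x)) A) x
    \<le> 5 * cmean (\<lambda>x. L2_set (\<lambda>i. cmod (f i x)) A)"
proof -
  define S where "S = (\<lambda>x. L2_set (\<lambda>i. cmod (f i x)) A)"
  have cS: "continuous_on UNIV S" unfolding S_def
    using assms(2) bandlimited_continuous by (auto intro!: continuous_intros)
  have "grid_mean M S x \<le> grid_mean M (\<lambda>x. 5 * cmean (\<lambda>y. S y * fejer M (x - y))) x"
    unfolding S_def by (intro grid_mean_mono L2_set_le_fejer_mean assms)
  also have "\<dots> = 5 * cmean (\<lambda>y. S y * grid_mean M (fejer M) (x - y))"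
  proof -
    have "cmean (\<lambda>y. S y * grid_mean M (fejer M) (x - y))
      = cmean (\<lambda>y. \<Sum>l<M. inverse (real M) * (S y * fejer M (x + 2*pi*real l/real M - y)))"
      unfolding grid_mean_def by (simp add: sum_distrib_left algebra_simps)
    also have "\<dots> = (\<Sum>l<M. inverse (real M) * cmean (\<lambda>y. S y * fejer M (x + 2*pi*real l/real M - y)))"
      using cS by (subst cmean_sum) (auto intro!: continuous_intros simp only: cmean_mult)
    finally show ?thesis by (simp only: grid_mean_def real_scaleR_def sum_distrib_left mult.left_commute)
  qed
  also have "\<dots> = 5 * cmean S" using assms(3) by (simp add: grid_mean_fejer)
  finally show ?thesis by (simp add: S_def)
qed

section \<open>A square function inequality for grid averages\<close>

text \<open>The triangle inequality for the average of the complex function with real part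
  \<open>a\<close> and imaginary part \<open>b\<close>.\<close>

lemma sqrt_grid_mean_le:
  fixes a b :: "real \<Rightarrow> real"
  shows "sqrt ((grid_mean N a x)\<^sup>2 + (grid_mean N b x)\<^sup>2) \<le> grid_mean N (\<lambda>x. sqrt ((a x)\<^sup>2 + (b x)\<^sup>2)) x"
proof -
  have "grid_mean N (\<lambda>x. Complex (a x) (b x)) x = Complex (grid_mean N a x) (grid_mean N b x)"
    by (simp add: grid_mean_def complex_eq_iff)
  then show ?thesis
    using norm_grid_mean_le[of N "\<lambda>x. Complex (a x) (b x)" x] by (simp add: complex_norm)
qed

text \<open>Applied below to each residue class of indices. The constant is
  \<open>6 = 1 + 5\<close>: one from the telescoping means of the increments \<open>v\<close>, five
  from the sampling bound on \<open>w\<close>.\<close>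

lemma cmean_L2_set_grid_mean_le:
  fixes f :: "nat \<Rightarrow> real \<Rightarrow> complex" and M :: "nat \<Rightarrow> nat"
  assumes M: "\<And>i. M i > 0" "mono M" and f: "\<And>i. bandlimited (M (Suc i)) (f i)"
  shows "cmean (\<lambda>x. L2_set (\<lambda>i. cmod (grid_mean (M i) (f i) x)) {..<n})
    \<le> 6 * cmean (\<lambda>x. L2_set (\<lambda>i. cmod (f i x)) {..<n})"
proof -
  define S where "S j x = L2_set (\<lambda>i. cmod (f i x)) {..<j}" for j x
  define w where "w j x = grid_mean (M j) (S j) x" for j x
  define h where "h j x = cmod (grid_mean (M j) (f j) x)" for j x
  define v where "v j x = sqrt ((w j x)\<^sup>2 + (h j x)\<^sup>2) - w j x" for j x
  define s where "s = cmean (S n)"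
  have cf: "continuous_on UNIV (f j)" for j using f bandlimited_continuous by blast
  have pf: "f j (x + 2*pi) = f j x" for j x using f bandlimited_periodic by blast
  have cS: "continuous_on UNIV (S j)" for j
    unfolding S_def by (intro continuous_intros cf)
  have pS: "S j (x + 2*pi) = S j x" for j x by (simp add: S_def pf)
  have S0: "0 \<le> S j x" for j x by (simp add: S_def)
  have cw: "continuous_on UNIV (w j)" for j
    unfolding w_def using continuous_on_grid_mean[OF cS] by simp
  have ch: "continuous_on UNIV (h j)" for j
    unfolding h_def by (intro continuous_intros continuous_on_grid_mean cf)
  have csq: "continuous_on UNIV (\<lambda>x. sqrt ((w j x)\<^sup>2 + (h j x)\<^sup>2))" for j
    by (intro continuous_intros cw ch)
  have cv: "continuous_on UNIV (v j)" for j
    unfolding v_def by (intro continuous_intros csq cw)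
  have w0: "0 \<le> w j x" for j x
    by (simp add: w_def grid_mean_def S0 sum_nonneg)
  have v0: "0 \<le> v j x" for j x
    using w0[of j x] by (simp add: v_def real_le_rsqrt)
  have SSuc: "S (Suc j) x = sqrt ((S j x)\<^sup>2 + (cmod (f j x))\<^sup>2)" for j x
    by (simp add: S_def lessThan_Suc add.commute)
  have step: "cmean (v j) \<le> cmean (S (Suc j)) - cmean (S j)" for j
  proof -
    have "sqrt ((w j x)\<^sup>2 + (h j x)\<^sup>2) \<le> grid_mean (M j) (S (Suc j)) x" for x
    proof -
      have "sqrt ((w j x)\<^sup>2 + (h j x)\<^sup>2)
          \<le> sqrt ((grid_mean (M j) (S j) x)\<^sup>2 + (grid_mean (M j) (\<lambda>x. cmod (f j x)) x)\<^sup>2)"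
        unfolding w_def h_def
        by (intro real_sqrt_le_mono add_left_mono power_mono norm_grid_mean_le norm_ge_zero)
      also have "\<dots> \<le> grid_mean (M j) (S (Suc j)) x"
        unfolding SSuc[abs_def] by (rule sqrt_grid_mean_le)
      finally show ?thesis .
    qed
    then have "cmean (\<lambda>x. sqrt ((w j x)\<^sup>2 + (h j x)\<^sup>2)) \<le> cmean (grid_mean (M j) (S (Suc j)))"
      by (intro cmean_mono csq continuous_on_grid_mean cS)
    also have "\<dots> = cmean (S (Suc j))" by (intro cmean_grid_mean cS pS M)
    finally have "cmean (\<lambda>x. sqrt ((w j x)\<^sup>2 + (h j x)\<^sup>2)) \<le> cmean (S (Suc j))" .
    moreover have "cmean (v j) = cmean (\<lambda>x. sqrt ((w j x)\<^sup>2 + (h j x)\<^sup>2)) - cmean (w j)"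
      unfolding v_def by (intro cmean_diff csq cw)
    moreover have "cmean (w j) = cmean (S j)"
      unfolding w_def using cmean_grid_mean[OF cS pS M(1)] by simp
    ultimately show ?thesis by simp
  qed
  have Smono: "cmean (S j) \<le> s" if "j \<le> n" for j
    unfolding s_def S_def using that
    by (intro cmean_mono continuous_intros cf) (auto simp: L2_set_def intro!: sum_mono2)
  have s0: "0 \<le> s" unfolding s_def by (intro cmean_nonneg cS S0)
  \<comment> \<open>Only terms \<open>i < j\<close> enter \<open>S j\<close>, and their degrees are
    at most \<open>M (Suc i) \<le> M j\<close>; this is where the degree hypothesis permits sampling
    on the grid of order \<open>M j\<close>.\<close>
  have ws: "w j x \<le> 5 * s" if "j < n" for j x
  proof -
    have "w j x \<le> 5 * cmean (S j)"
      unfolding w_def S_def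
    proof (rule grid_mean_L2_set_le)
      fix i assume "i \<in> {..<j}"
      then have "M (Suc i) \<le> M j" using M(2) by (auto intro: monoD)
      then show "bandlimited (M j) (f i)" using f bandlimited_mono by blast
    qed (use M in auto)
    also have "\<dots> \<le> 5 * s" using Smono[of j] that by simp
    finally show ?thesis .
  qed
  \<comment> \<open>From \<open>h\<^sup>2 = v\<^sup>2 + 2 * v * w\<close> and
    \<open>w \<le> 5 * s\<close>, summation gives at most \<open>V\<^sup>2 + 10 * s * V\<close>, and
    completing the square removes the root.\<close>
  have pt: "L2_set (\<lambda>i. h i x) {..<n} \<le> (\<Sum>j<n. v j x) + 5 * s" for x
  proof -
    let ?V = "\<Sum>j<n. v j x"
    have V0: "0 \<le> ?V" by (intro sum_nonneg v0)
    have "(h j x)\<^sup>2 \<le> (v j x)\<^sup>2 + 10 * s * v j x" if "j < n" for j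
    proof -
      have "(v j x + w j x)\<^sup>2 = (w j x)\<^sup>2 + (h j x)\<^sup>2" by (simp add: v_def)
      then have "(h j x)\<^sup>2 = (v j x)\<^sup>2 + 2 * (v j x * w j x)"
        by (simp add: power2_eq_square algebra_simps)
      moreover have "v j x * w j x \<le> v j x * (5 * s)"
        using ws[OF that] v0 by (intro mult_left_mono) auto
      ultimately show ?thesis by (simp add: algebra_simps)
    qed
    then have "(\<Sum>j<n. (h j x)\<^sup>2) \<le> (\<Sum>j<n. (v j x)\<^sup>2 + 10 * s * v j x)"
      by (intro sum_mono) auto
    also have "\<dots> = (\<Sum>j<n. (v j x)\<^sup>2) + 10 * s * ?V"
      by (simp add: sum.distrib sum_distrib_left)
    also have "(\<Sum>j<n. (v j x)\<^sup>2) \<le> ?V\<^sup>2"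
    proof -
      have "L2_set (\<lambda>j. v j x) {..<n} \<le> ?V" by (intro L2_set_le_sum v0)
      then have "(L2_set (\<lambda>j. v j x) {..<n})\<^sup>2 \<le> ?V\<^sup>2" by (intro power_mono) auto
      then show ?thesis by (simp add: L2_set_def sum_nonneg)
    qed
    finally have "(\<Sum>j<n. (h j x)\<^sup>2) \<le> ?V\<^sup>2 + 10 * s * ?V" by simp
    also have "\<dots> \<le> (?V + 5 * s)\<^sup>2" by (simp add: power2_eq_square algebra_simps)
    finally show ?thesis
      unfolding L2_set_def using V0 s0 by (intro real_le_lsqrt) (auto intro: sum_nonneg)
  qed
  have "cmean (\<lambda>x. L2_set (\<lambda>i. h i x) {..<n}) \<le> cmean (\<lambda>x. (\<Sum>j<n. v j x) + 5 * s)"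
    by (intro cmean_mono continuous_intros ch cv pt)
  also have "\<dots> = (\<Sum>j<n. cmean (v j)) + 5 * s"
    by (simp add: cmean_add cmean_sum cv continuous_on_sum)
  also have "(\<Sum>j<n. cmean (v j)) \<le> (\<Sum>j<n. cmean (S (Suc j)) - cmean (S j))"
    by (intro sum_mono step)
  also have "\<dots> = s"
  proof -
    have "S 0 = (\<lambda>_. 0)" by (simp add: S_def fun_eq_iff)
    then show ?thesis using sum_lessThan_telescope[of "\<lambda>j. cmean (S j)" n] by (simp add: s_def)
  qed
  finally show ?thesis by (simp add: h_def s_def S_def[abs_def])
qed

section \<open>The inequality of Paley\<close>

definition analytic_poly :: "nat \<Rightarrow> (nat \<Rightarrow> complex) \<Rightarrow> real \<Rightarrow> complex" where
  "analytic_poly D a y = (\<Sum>m\<le>D. a m * cis (real m * y))"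

lemma continuous_on_analytic_poly [continuous_intros]:
  "continuous_on S f \<Longrightarrow> continuous_on S (\<lambda>x. analytic_poly D a (f x))"
  unfolding analytic_poly_def by (intro continuous_intros)

lemma analytic_poly_convolution:
  assumes "n > 0"
  shows "cmean (\<lambda>y. analytic_poly D a y * (of_real (fejer n (x - y)) * cis (of_int k * (x - y))))
    = analytic_poly D (\<lambda>m. of_real (fejer_coeff n (int m - k)) * a m) x"
proof -
  have "cmean (\<lambda>y. analytic_poly D a y * (of_real (fejer n (x - y)) * cis (of_int k * (x - y))))
    = cmean (\<lambda>y. \<Sum>m\<le>D. a m * (cis (of_int (int m) * y) *
        (of_real (fejer n (x - y)) * cis (of_int k * (x - y)))))"
    by (simp add: analytic_poly_def sum_distrib_right mult.assoc)
  also have "\<dots> = (\<Sum>m\<le>D. a m * (of_real (fejer_coeff n (int m - k)) * cis (of_int (int m) * x)))"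
    by (subst cmean_sum) (auto intro!: continuous_intros simp only: cmean_mult fejer_convolution[OF assms])
  finally show ?thesis by (simp add: analytic_poly_def mult_ac)
qed

lemma cmean_analytic_poly_coeff:
  assumes "d \<le> D"
  shows "cmean (\<lambda>x. analytic_poly D a x * cis (- (real d * x))) = a d"
proof -
  have "cmean (\<lambda>x. analytic_poly D a x * cis (- (real d * x)))
    = cmean (\<lambda>x. \<Sum>m\<le>D. a m * cis (of_int (int m - int d) * x))"
    by (simp add: analytic_poly_def sum_distrib_right mult.assoc cis_mult left_diff_distrib)
  also have "\<dots> = (\<Sum>m\<le>D. a m * (if m = d then 1 else 0))"
    by (subst cmean_sum) (auto intro!: continuous_intros simp only: cmean_mult cmean_cis, simp)
  also have "\<dots> = a d" using assms by (simp add: if_distrib[of "(*) _"] sum.delta cong: if_cong)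
  finally show ?thesis .
qed

lemma exists_unit_phase: "\<exists>u. cmod u = 1 \<and> u * z = of_real (cmod z)"
proof (cases "z = 0")
  case False
  then show ?thesis
    by (intro exI[of _ "cnj z / of_real (cmod z)"])
      (simp add: norm_divide mult.commute complex_norm_square[symmetric] power2_eq_square)
qed (auto intro: exI[of _ 1])

text \<open>The test function is allowed a free term at frequency \<open>d\<close> because it only meets the
  (vanishing) negative coefficients of an analytic polynomial; that term makes the two
  oscillating parts purely imaginary relative to the constant one.\<close>

lemma paley_step_dual:
  assumes d: "0 < d" "d \<le> D" and pq: "0 \<le> p" "0 \<le> q" "p\<^sup>2 + q\<^sup>2 = (1::real)"
  shows "p * cmean (\<lambda>x. cmod (analytic_poly D (\<lambda>m. of_real (fejer_coeff d (int m)) * a m) x))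
      + q * (cmod (a d) / 2) \<le> cmean (\<lambda>x. cmod (analytic_poly D a x))"
proof -
  define F where "F = analytic_poly D a"
  define K where "K x y = fejer d (x - y)" for x y
  define G where "G = analytic_poly D (\<lambda>m. of_real (fejer_coeff d (int m)) * a m)"
  define H where "H = analytic_poly D (\<lambda>m. of_real (fejer_coeff d (int m - int d)) * a m)"
  have cF: "continuous_on S (\<lambda>x. F (g x))" if "continuous_on S g" for S :: "'s::topological_space set" and g
    unfolding F_def by (intro continuous_intros that)
  have cG: "continuous_on UNIV G" "continuous_on UNIV H"
    unfolding G_def H_def by (auto intro!: continuous_intros)
  have G: "cmean (\<lambda>y. F y * of_real (K x y)) = G x" for x
    using analytic_poly_convolution[OF d(1), of D a x 0] by (simp add: F_def G_def K_def)
  have H: "cmean (\<lambda>y. F y * (of_real (K x y) * cis (real d * (x - y)))) = H x" for x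
    using analytic_poly_convolution[OF d(1), of D a x "int d"] by (simp add: F_def H_def K_def)
  \<comment> \<open>The multiplier is centred at \<open>- d\<close>, and every frequency
    \<open>m \<ge> 0\<close> is at distance at least \<open>d\<close> from it: analyticity enters
    here.\<close>
  have H0: "cmean (\<lambda>y. F y * (of_real (K x y) * cis (- (real d * (x - y))))) = 0" for x
  proof -
    have "fejer_coeff d (int m + int d) = 0" for m
      using d(1) by (simp add: fejer_coeff_def field_simps)
    then show ?thesis
      using analytic_poly_convolution[OF d(1), of D a x "- int d"]
      by (simp add: F_def K_def analytic_poly_def)
  qed
  have pt: "p * cmod (G x) + q / 2 * cmod (H x) \<le> cmean (\<lambda>y. cmod (F y) * K x y)" for x
  proof -
    obtain u where u: "cmod u = 1" "u * G x = of_real (cmod (G x))"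
      using exists_unit_phase by blast
    obtain u' where u': "cmod u' = 1" "u' * H x = of_real (cmod (H x))"
      using exists_unit_phase by blast
    \<comment> \<open>The phase makes \<open>u * b * H x\<close> equal to
      \<open>q / 2 * cmod (H x)\<close>. Subtracting the conjugate leaves
      \<open>2 * \<i> * Im (b * e y)\<close>, so \<open>cmod (f y)\<close> is at most
      \<open>sqrt (p\<^sup>2 + q\<^sup>2) = 1\<close>.\<close>
    define b where "b = of_real (q / 2) * u' * cnj u"
    define e where "e y = cis (real d * (x - y))" for y
    define f where "f y = u * (of_real p + (b * e y - cnj (b * e y)))" for y
    have ub: "u * b = of_real (q / 2) * u'"
    proof -
      have "u * cnj u = 1" using u(1) by (simp add: complex_norm_square[symmetric])
      then show ?thesis by (simp add: b_def mult_ac)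
    qed
    have cb: "cmod b = q / 2" using u u' pq by (simp add: b_def norm_mult)
    have f1: "cmod (f y) \<le> 1" for y
    proof -
      define w where "w = b * e y"
      have "cmod w = q / 2" using cb by (simp add: w_def e_def norm_mult)
      then have "\<bar>Im w\<bar> \<le> q / 2" using abs_Im_le_cmod[of w] by simp
      then have "\<bar>Im w\<bar>\<^sup>2 \<le> (q / 2)\<^sup>2" by (intro power_mono) auto
      then have "p\<^sup>2 + (2 * Im w)\<^sup>2 \<le> 1" using pq by (simp add: power_mult_distrib power_divide)
      moreover have "of_real p + (w - cnj w) = Complex p (2 * Im w)"
        by (simp add: complex_eq_iff)
      ultimately have "cmod (of_real p + (w - cnj w)) \<le> 1" by (simp add: complex_norm)
      then show ?thesis using u by (simp add: f_def norm_mult flip: w_def del: complex_cnj_mult)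
    qed
    have ce: "continuous_on UNIV e" unfolding e_def by (intro continuous_intros)
    have cK: "continuous_on UNIV (K x)" unfolding K_def by (intro continuous_intros)
    have cf: "continuous_on UNIV f" unfolding f_def by (intro continuous_intros ce)
    have "cmean (\<lambda>y. F y * (of_real (K x y) * f y))
      = cmean (\<lambda>y. u * of_real p * (F y * of_real (K x y))
          + (u * b * (F y * (of_real (K x y) * cis (real d * (x - y))))
          - u * cnj b * (F y * (of_real (K x y) * cis (- (real d * (x - y)))))))"
      by (simp add: f_def e_def cis_cnj algebra_simps)
    also have "\<dots> = u * of_real p * G x + (u * b * H x - u * cnj b * 0)"
      by (subst cmean_add, (intro continuous_intros cF cK)+, subst cmean_diff,
          (intro continuous_intros cF cK)+, simp only: cmean_mult G H H0)
    also have "\<dots> = of_real (p * cmod (G x) + q / 2 * cmod (H x))"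
      unfolding ub using u(2) u'(2) by (simp add: mult.commute[of u "of_real p"] mult.assoc)
    finally have "cmod (cmean (\<lambda>y. F y * (of_real (K x y) * f y))) = p * cmod (G x) + q / 2 * cmod (H x)"
      using pq by (simp only: norm_of_real) simp
    moreover have "cmod (cmean (\<lambda>y. F y * (of_real (K x y) * f y))) \<le> cmean (\<lambda>y. cmod (F y) * K x y)"
    proof (rule norm_cmean_le)
      fix y
      have "cmod (F y) * (K x y * cmod (f y)) \<le> cmod (F y) * (K x y * 1)"
        using f1 by (intro mult_left_mono) (auto simp: K_def)
      then show "cmod (F y * (of_real (K x y) * f y)) \<le> cmod (F y) * K x y"
        by (simp add: norm_mult K_def)
    qed (intro continuous_intros cF cK cf)+
    ultimately show ?thesis by simp
  qed
  have cc: "continuous_on UNIV (\<lambda>(x,y). cmod (F y) * K x y)"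
    unfolding K_def split_def by (intro continuous_intros cF)
  have "p * cmean (\<lambda>x. cmod (G x)) + q / 2 * cmean (\<lambda>x. cmod (H x))
      = cmean (\<lambda>x. p * cmod (G x) + q / 2 * cmod (H x))"
    using cG by (subst cmean_add) (auto intro!: continuous_intros simp only: cmean_mult)
  also have "\<dots> \<le> cmean (\<lambda>x. cmean (\<lambda>y. cmod (F y) * K x y))"
    using cG by (intro cmean_mono pt continuous_on_cmean cc) (auto intro!: continuous_intros)
  also have "\<dots> = cmean (\<lambda>y. cmean (\<lambda>x. cmod (F y) * K x y))"
    by (rule cmean_swap[OF cc])
  also have "\<dots> = cmean (\<lambda>y. cmod (F y))"
    using cmean_fejer[OF d(1), of "- _"] by (simp add: cmean_mult K_def)
  finally have 1: "p * cmean (\<lambda>x. cmod (G x)) + q / 2 * cmean (\<lambda>x. cmod (H x)) \<le> cmean (\<lambda>y. cmod (F y))" .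
  \<comment> \<open>The multiplier defining \<open>H\<close> is 1 at its centre \<open>d\<close>, so
    \<open>H\<close> has the same \<open>d\<close>-th coefficient as \<open>F\<close>.\<close>
  have "cmod (a d) = cmod (cmean (\<lambda>x. H x * cis (- (real d * x))))"
    unfolding H_def cmean_analytic_poly_coeff[OF d(2)] by (simp add: fejer_coeff_def)
  also have "\<dots> \<le> cmean (\<lambda>x. cmod (H x))"
    using cG by (intro norm_cmean_le) (auto intro!: continuous_intros simp: norm_mult)
  finally have "q / 2 * cmod (a d) \<le> q / 2 * cmean (\<lambda>x. cmod (H x))"
    using pq by (intro mult_left_mono) auto
  with 1 show ?thesis by (simp add: F_def G_def)
qed

text \<open>The bound \<open>paley_step_dual\<close> is optimised over the unit circle:
  \<open>p\<close> and \<open>q\<close> are taken proportional to \<open>A\<close> and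
  \<open>B\<close>, which turns the linear bound into a Pythagorean one. The factor 1/4 comes from
  \<open>B = cmod (a d) / 2\<close>.\<close>

lemma paley_step:
  assumes d: "0 < d" "d \<le> D"
  shows "(cmean (\<lambda>x. cmod (analytic_poly D (\<lambda>m. of_real (fejer_coeff d (int m)) * a m) x)))\<^sup>2
      + (cmod (a d))\<^sup>2 / 4 \<le> (cmean (\<lambda>x. cmod (analytic_poly D a x)))\<^sup>2"
proof -
  define A where "A = cmean (\<lambda>x. cmod (analytic_poly D (\<lambda>m. of_real (fejer_coeff d (int m)) * a m) x))"
  define B where "B = cmod (a d) / 2"
  define X where "X = cmean (\<lambda>x. cmod (analytic_poly D a x))"
  define r where "r = sqrt (A\<^sup>2 + B\<^sup>2)"
  have A0: "0 \<le> A" unfolding A_def by (intro cmean_nonneg) (auto intro!: continuous_intros)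
  have B0: "0 \<le> B" by (simp add: B_def)
  have r2: "r\<^sup>2 = A\<^sup>2 + B\<^sup>2" by (simp add: r_def)
  have "r \<le> X"
  proof (cases "r = 0")
    case True
    then show ?thesis unfolding X_def by (auto intro!: cmean_nonneg continuous_intros)
  next
    case False
    then have r: "r > 0" using r2 by (simp add: r_def less_le)
    have "A / r * A + B / r * B \<le> X"
      unfolding X_def using r r2 A0 B0
      by (subst (2) A_def, subst (2) B_def, intro paley_step_dual d)
        (auto simp: power_divide add_divide_distrib[symmetric])
    moreover have "A / r * A + B / r * B = r"
      using r r2 by (simp add: field_simps power2_eq_square)
    ultimately show ?thesis by simp
  qed
  then have "r\<^sup>2 \<le> X\<^sup>2" by (intro power_mono) (auto simp: r_def)
  then show ?thesis unfolding r2 by (simp add: A_def B_def X_def power_divide)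
qed

text \<open>Induction from the last index: \<open>paley_step\<close> splits off the coefficient at
  \<open>d (Suc n)\<close>, and the induction hypothesis is applied to the damped coefficients
  \<open>a'\<close>. Each coefficient collects one damping factor for every later index.\<close>

lemma paley_product:
  fixes d :: "nat \<Rightarrow> nat"
  assumes "\<And>k. k \<in> {1..n} \<Longrightarrow> 0 < d k \<and> d k \<le> D"
  shows "(\<Sum>k=1..n. (cmod (a (d k)) * (\<Prod>j\<in>{k<..n}. fejer_coeff (d j) (int (d k))))\<^sup>2) / 4
    \<le> (cmean (\<lambda>x. cmod (analytic_poly D a x)))\<^sup>2"
  using assms
proof (induction n arbitrary: a)
  case (Suc n)
  define a' where "a' m = of_real (fejer_coeff (d (Suc n)) (int m)) * a m" for m
  have [simp]: "0 \<le> fejer_coeff i m" for i m by (simp add: fejer_coeff_def)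
  have "(\<Sum>k=1..n. (cmod (a (d k)) * (\<Prod>j\<in>{k<..Suc n}. fejer_coeff (d j) (int (d k))))\<^sup>2)
      = (\<Sum>k=1..n. (cmod (a' (d k)) * (\<Prod>j\<in>{k<..n}. fejer_coeff (d j) (int (d k))))\<^sup>2)"
  proof (rule sum.cong[OF refl])
    fix k assume k: "k \<in> {1..n}"
    then have "{k<..Suc n} = insert (Suc n) {k<..n}" by auto
    then show "(cmod (a (d k)) * (\<Prod>j\<in>{k<..Suc n}. fejer_coeff (d j) (int (d k))))\<^sup>2
      = (cmod (a' (d k)) * (\<Prod>j\<in>{k<..n}. fejer_coeff (d j) (int (d k))))\<^sup>2"
      by (simp add: a'_def norm_mult mult_ac)
  qed
  moreover have "(\<Sum>k=1..n. (cmod (a' (d k)) * (\<Prod>j\<in>{k<..n}. fejer_coeff (d j) (int (d k))))\<^sup>2) / 4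
      \<le> (cmean (\<lambda>x. cmod (analytic_poly D a' x)))\<^sup>2"
    using Suc.prems by (intro Suc.IH) auto
  moreover have "(cmean (\<lambda>x. cmod (analytic_poly D a' x)))\<^sup>2 + (cmod (a (d (Suc n))))\<^sup>2 / 4
      \<le> (cmean (\<lambda>x. cmod (analytic_poly D a x)))\<^sup>2"
    unfolding a'_def using Suc.prems by (intro paley_step) auto
  ultimately show ?case by (simp add: add_divide_distrib)
qed simp

lemma lacunary_ratio:
  fixes d :: "nat \<Rightarrow> nat" and q :: real
  assumes "\<And>k. k \<ge> 1 \<Longrightarrow> real (d (k+1)) \<ge> q * real (d k)" "q > 0" "k \<ge> 1"
  shows "real (d (k + i)) \<ge> q ^ i * real (d k)"
proof (induction i)
  case (Suc i)
  have "q ^ Suc i * real (d k) \<le> q * real (d (k + i))" using Suc assms(2) by (simp add: mult.assoc)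
  also have "\<dots> \<le> real (d (k + Suc i))" using assms(1)[of "k+i"] assms(3) by simp
  finally show ?case .
qed simp

text \<open>Follows from \<open>1 \<le> (1 - x) * (1 + x / (1 - r))\<close>. It bounds products of
  damping factors from below by the exponential of a sum.\<close>

lemma one_minus_ge_exp:
  fixes x :: real
  assumes "0 \<le> x" "x \<le> r" "r < 1"
  shows "exp (- (x / (1 - r))) \<le> 1 - x"
proof -
  have "1 \<le> (1 - x) * (1 + x / (1 - r))"
  proof -
    have "x * (1 - r) \<le> x * (1 - x)" using assms by (intro mult_left_mono) auto
    then show ?thesis using assms by (simp add: field_simps)
  qed
  also have "\<dots> \<le> (1 - x) * exp (x / (1 - r))"
    using assms exp_ge_add_one_self[of "x / (1 - r)"] by (intro mult_left_mono) auto
  finally show ?thesis by (simp add: exp_minus field_simps)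
qed

text \<open>Lacunarity gives \<open>d k / d j \<le> r ^ (j - k)\<close> for \<open>k < j\<close>, so
  the damping products in \<open>paley_product\<close> are bounded below through a geometric series,
  uniformly in \<open>k\<close> and \<open>n\<close>.\<close>

lemma paley:
  assumes "lacunary d"
  obtains c where "c > 0"
    "\<And>n D a. (\<And>k. k \<in> {1..n} \<Longrightarrow> d k \<le> D) \<Longrightarrow>
      c * L2_set (\<lambda>k. cmod (a (d k))) {1..n} \<le> cmean (\<lambda>x. cmod (analytic_poly D a x))"
proof -
  obtain q where q: "q > 1" "\<And>k. k \<ge> 1 \<Longrightarrow> real (d (k+1)) \<ge> q * real (d k)"
    and d0: "\<And>k. k \<ge> 1 \<Longrightarrow> d k > 0"
    using assms unfolding lacunary_def by auto
  define r where "r = 1 / q"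
  have r: "0 < r" "r < 1" using q by (auto simp: r_def)
  \<comment> \<open>One factor \<open>1 / (1 - r)\<close> comes from
    \<open>one_minus_ge_exp\<close>, the other from the geometric series.\<close>
  define c where "c = exp (- (1 / (1 - r)\<^sup>2))"
  have prod: "c \<le> (\<Prod>j\<in>{k<..n}. fejer_coeff (d j) (int (d k)))" if k: "k \<ge> 1" for k n
  proof -
    have coeff: "exp (- (r ^ (j - k) / (1 - r))) \<le> fejer_coeff (d j) (int (d k))" if "k < j" for j
    proof -
      define x where "x = real (d k) / real (d j)"
      have "q ^ (j - k) * real (d k) \<le> real (d j)"
        using lacunary_ratio[where d=d and q=q and k=k and i="j - k"] q k that by auto
      then have x1: "x \<le> r ^ (j - k)"
        using d0[of j] k that q by (simp add: x_def r_def field_simps power_divide)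
      have "r ^ (j - k) \<le> r ^ 1" using r that by (intro power_decreasing) auto
      then have x2: "x \<le> r" using x1 by simp
      have x0: "0 \<le> x" by (simp add: x_def)
      have "exp (- (r ^ (j - k) / (1 - r))) \<le> exp (- (x / (1 - r)))"
        using x1 r by (simp add: divide_right_mono)
      also have "\<dots> \<le> 1 - x" using one_minus_ge_exp x0 x2 r by blast
      also have "\<dots> \<le> fejer_coeff (d j) (int (d k))" by (simp add: x_def fejer_coeff_def)
      finally show ?thesis .
    qed
    have "(\<Sum>j\<in>{k<..n}. r ^ (j - k)) \<le> 1 / (1 - r)"
    proof -
      have "(\<Sum>j\<in>{k<..n}. r ^ (j - k)) = (\<Sum>i\<in>(\<lambda>j. j - k) ` {k<..n}. r ^ i)"
        by (subst sum.reindex) (auto simp: inj_on_def)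
      also have "\<dots> \<le> (\<Sum>i. r ^ i)"
        using r by (intro sum_le_suminf) (auto intro: summable_geometric)
      finally show ?thesis using r by (simp add: suminf_geometric)
    qed
    then have "(\<Sum>j\<in>{k<..n}. r ^ (j - k)) / (1 - r) \<le> 1 / (1 - r) / (1 - r)"
      using r by (intro divide_right_mono) auto
    then have "c \<le> exp (\<Sum>j\<in>{k<..n}. - (r ^ (j - k) / (1 - r)))"
      by (simp add: c_def sum_negf sum_divide_distrib power2_eq_square)
    also have "\<dots> = (\<Prod>j\<in>{k<..n}. exp (- (r ^ (j - k) / (1 - r))))"
      by (simp add: exp_sum)
    also have "\<dots> \<le> (\<Prod>j\<in>{k<..n}. fejer_coeff (d j) (int (d k)))"
      by (intro prod_mono) (auto intro: coeff)
    finally show ?thesis .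
  qed
  have c0: "c > 0" by (simp add: c_def)
  show ?thesis
  proof (rule that[of "c / 2"])
    fix n D and a :: "nat \<Rightarrow> complex" assume D: "\<And>k. k \<in> {1..n} \<Longrightarrow> d k \<le> D"
    let ?X = "cmean (\<lambda>x. cmod (analytic_poly D a x))"
    have "(c / 2 * L2_set (\<lambda>k. cmod (a (d k))) {1..n})\<^sup>2 = (\<Sum>k=1..n. (cmod (a (d k)) * c)\<^sup>2) / 4"
      by (simp add: L2_set_def power_mult_distrib sum_nonneg power_divide mult.commute
          flip: sum_distrib_left)
    also have "\<dots> \<le> (\<Sum>k=1..n. (cmod (a (d k)) * (\<Prod>j\<in>{k<..n}. fejer_coeff (d j) (int (d k))))\<^sup>2) / 4"
      using prod c0 by (intro divide_right_mono sum_mono power_mono mult_left_mono) auto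
    also have "\<dots> \<le> ?X\<^sup>2"
      using D d0 by (intro paley_product) auto
    finally show "c / 2 * L2_set (\<lambda>k. cmod (a (d k))) {1..n} \<le> ?X"
      by (rule power2_le_imp_le) (auto intro!: cmean_nonneg continuous_intros)
  qed (use c0 in simp)
qed

section \<open>Slices along antidiagonals\<close>

definition slice :: "(nat \<times> nat \<Rightarrow> complex) \<Rightarrow> nat \<Rightarrow> real \<Rightarrow> complex" where
  "slice c m s = (\<Sum>i\<le>m. c (i, m - i) * cis (real i * s))"

lemma continuous_on_slice [continuous_intros]:
  "continuous_on S f \<Longrightarrow> continuous_on S (\<lambda>x. slice c m (f x))"
  unfolding slice_def by (intro continuous_intros)

lemma bandlimited_slice:
  assumes "m \<le> M" shows "bandlimited M (slice c m)"
proof -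
  have "bandlimited M (\<lambda>s. \<Sum>i\<le>m. c (i, m - i) * cis (of_int (int i) * s))"
    using assms by (intro bandlimited_sum bandlimited_mult bandlimited_cis) auto
  then show ?thesis by (simp add: slice_def[abs_def])
qed

lemma trig_poly2_shear:
  assumes D: "\<And>n. c n \<noteq> 0 \<Longrightarrow> fst n + snd n \<le> D"
  shows "trig_poly2 c (s + t) t = analytic_poly D (\<lambda>m. slice c m s) t"
proof -
  let ?T = "{(i,j). i + j \<le> D}"
  have fin: "finite ?T" by (rule finite_subset[of _ "{..D} \<times> {..D}"]) auto
  have "trig_poly2 c (s + t) t
      = (\<Sum>n\<in>{n. c n \<noteq> 0}. c n * cis (real (fst n) * s) * cis (real (fst n + snd n) * t))"
    unfolding trig_poly2_def
    by (intro sum.cong refl) (simp add: cis_conv_exp exp_add[symmetric] algebra_simps)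
  also have "\<dots> = (\<Sum>n\<in>?T. c n * cis (real (fst n) * s) * cis (real (fst n + snd n) * t))"
    using D fin by (intro sum.mono_neutral_left) auto
  also have "\<dots> = (\<Sum>(i,j)\<in>?T. c (i,j) * cis (real i * s) * cis (real (i + j) * t))"
    by (simp add: split_def)
  also have "\<dots> = (\<Sum>m\<le>D. \<Sum>i\<le>m. c (i, m - i) * cis (real i * s) * cis (real (i + (m - i)) * t))"
    by (rule sum.triangle_reindex_eq)
  also have "\<dots> = analytic_poly D (\<lambda>m. slice c m s) t"
    by (simp add: analytic_poly_def slice_def sum_distrib_right)
  finally show ?thesis .
qed

text \<open>The shear preserves the measure: by Fubini it is, for each fixed \<open>t\<close>, a
  translation of the first variable, which \<open>cmean_shift\<close> absorbs.\<close>

lemma L1_norm_T2_shear: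
  assumes D: "\<And>n. c n \<noteq> 0 \<Longrightarrow> fst n + snd n \<le> D"
  shows "L1_norm_T2 (trig_poly2 c)
    = cmean (\<lambda>s. cmean (\<lambda>t. cmod (analytic_poly D (\<lambda>m. slice c m s) t)))"
proof -
  define f where "f s t = cmod (trig_poly2 c s t)" for s t
  have cT: "continuous_on UNIV (\<lambda>x. trig_poly2 c (g x) (h x))"
    if "continuous_on UNIV g" "continuous_on UNIV h" for g h :: "'s::topological_space \<Rightarrow> real"
    unfolding trig_poly2_def by (intro continuous_intros that)
  have cf: "continuous_on UNIV (\<lambda>(s,t). f s t)"
    unfolding f_def split_def by (intro continuous_intros cT)
  have cg: "continuous_on UNIV (\<lambda>(t,s). f (s + t) t)"
    unfolding f_def split_def by (intro continuous_intros cT)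
  have cf1: "continuous_on UNIV (\<lambda>s. f s t)" for t
    unfolding f_def by (intro continuous_intros cT)
  have per: "f (s + 2*pi) t = f s t" for s t
  proof -
    have "exp (\<i> * (of_nat m * of_real (s + 2*pi) + z)) = exp (\<i> * (of_nat m * of_real s + z))" for m z
    proof -
      have "\<i> * (of_nat m * of_real (s + 2*pi) + z)
          = \<i> * (of_nat m * of_real s + z) + \<i> * (of_int (int m) * (of_real pi * 2))"
        by (simp add: algebra_simps)
      then show ?thesis by (simp only: exp_plus_2pin)
    qed
    then show ?thesis by (simp add: f_def trig_poly2_def)
  qed
  have "integral (cbox (0,0) (2*pi, 2*pi)) (\<lambda>(s,t). f s t)
      = integral (cbox 0 (2*pi)) (\<lambda>s. integral (cbox 0 (2*pi)) (\<lambda>t. f s t))"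
    using integral_prod_continuous[OF continuous_on_subset[OF cf subset_UNIV], of 0 0 "2*pi" "2*pi"]
    by simp
  then have "L1_norm_T2 (trig_poly2 c) = cmean (\<lambda>s. cmean (f s))"
    by (simp add: L1_norm_T2_def cmean_def f_def[abs_def] power2_eq_square field_simps)
  also have "\<dots> = cmean (\<lambda>t. cmean (\<lambda>s. f s t))" by (rule cmean_swap[OF cf])
  also have "\<dots> = cmean (\<lambda>t. cmean (\<lambda>s. f (s + t) t))"
    by (intro arg_cong[where f=cmean] ext cmean_shift[symmetric] cf1 per)
  also have "\<dots> = cmean (\<lambda>s. cmean (\<lambda>t. f (s + t) t))" by (rule cmean_swap[OF cg])
  moreover have "trig_poly2 c (s + t) t = analytic_poly D (\<lambda>m. slice c m s) t" for s t
    using D by (rule trig_poly2_shear)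
  ultimately show ?thesis by (simp add: f_def)
qed

lemma continuous_on_cmean_analytic_poly_slice:
  "continuous_on UNIV (\<lambda>s. cmean (\<lambda>t. cmod (analytic_poly D (\<lambda>m. slice c m s) t)))"
  by (rule continuous_on_cmean) (auto simp: analytic_poly_def split_def intro!: continuous_intros)

lemma cmean_analytic_poly_le_L2:
  "cmean (\<lambda>x. cmod (analytic_poly D a x)) \<le> L2_set (\<lambda>m. cmod (a m)) {..D}"
proof -
  let ?F = "analytic_poly D a"
  define r where "r = L2_set (\<lambda>m. cmod (a m)) {..D}"
  have r2: "r\<^sup>2 = (\<Sum>m\<le>D. (cmod (a m))\<^sup>2)" by (simp add: r_def L2_set_def sum_nonneg)
  have "complex_of_real (cmean (\<lambda>x. (cmod (?F x))\<^sup>2)) = cmean (\<lambda>x. complex_of_real ((cmod (?F x))\<^sup>2))"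
    by (rule cmean_of_real[symmetric]) (intro continuous_intros)
  also have "\<dots> = cmean (\<lambda>x. \<Sum>m\<le>D. cnj (a m) * (?F x * cis (- (real m * x))))"
  proof -
    have "complex_of_real ((cmod (?F x))\<^sup>2) = (\<Sum>m\<le>D. cnj (a m) * (?F x * cis (- (real m * x))))" for x
    proof -
      have "complex_of_real ((cmod (?F x))\<^sup>2) = ?F x * cnj (?F x)" by (rule complex_norm_square)
      also have "cnj (?F x) = (\<Sum>m\<le>D. cnj (a m) * cis (- (real m * x)))"
        by (simp add: analytic_poly_def cis_cnj)
      finally show ?thesis by (simp add: sum_distrib_left mult_ac)
    qed
    then show ?thesis by presburger
  qed
  also have "\<dots> = (\<Sum>m\<le>D. cnj (a m) * a m)"
    by (subst cmean_sum)
      (auto intro!: continuous_intros sum.cong simp: cmean_mult cmean_analytic_poly_coeff)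
  also have "\<dots> = of_real (r\<^sup>2)"
    unfolding r2 by (simp add: complex_norm_square mult.commute del: of_real_power)
  finally have P: "cmean (\<lambda>x. (cmod (?F x))\<^sup>2) = r\<^sup>2" by (simp only: of_real_eq_iff)
  show ?thesis
  proof (cases "r = 0")
    case True
    then have "a m = 0" if "m \<le> D" for m using that by (simp add: r_def L2_set_eq_0_iff)
    then show ?thesis by (simp add: analytic_poly_def)
  next
    case False
    then have r: "r > 0" by (simp add: r_def less_le)
    \<comment> \<open>The arithmetic-geometric inequality stands in for Cauchy-Schwarz; the weight
      \<open>r\<close> makes both halves equal after taking means.\<close>
    have "cmean (\<lambda>x. cmod (?F x)) \<le> cmean (\<lambda>x. 1 / (2 * r) * (cmod (?F x))\<^sup>2 + r / 2)"
    proof (rule cmean_mono)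
      fix x
      have "0 \<le> (cmod (?F x) - r)\<^sup>2 / (2 * r)" using r by simp
      then show "cmod (?F x) \<le> 1 / (2 * r) * (cmod (?F x))\<^sup>2 + r / 2"
        using r by (simp add: power2_eq_square field_simps)
    qed (intro continuous_intros)+
    also have "\<dots> = 1 / (2 * r) * r\<^sup>2 + r / 2"
      by (subst cmean_add, (intro continuous_intros)+, simp only: cmean_mult P cmean_const)
    also have "\<dots> = r" using r by (simp add: power2_eq_square)
    finally show ?thesis by (simp add: r_def)
  qed
qed

text \<open>The \<open>L\<^sup>2\<close> bound is used for each fixed \<open>s\<close>; reindexing
  along \<open>d\<close> is possible because all other slices vanish.\<close>

lemma L1_norm_T2_le_slices:
  assumes D: "\<And>n. c n \<noteq> 0 \<Longrightarrow> fst n + snd n \<le> D"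
    and d: "inj_on d A" "d ` A \<subseteq> {..D}" "\<And>m s. m \<notin> d ` A \<Longrightarrow> slice c m s = 0"
  shows "L1_norm_T2 (trig_poly2 c) \<le> cmean (\<lambda>s. L2_set (\<lambda>k. cmod (slice c (d k) s)) A)"
proof -
  have "L2_set (\<lambda>m. cmod (slice c m s)) {..D} = L2_set (\<lambda>k. cmod (slice c (d k) s)) A" for s
  proof -
    have "(\<Sum>m\<le>D. (cmod (slice c m s))\<^sup>2) = (\<Sum>m\<in>d ` A. (cmod (slice c m s))\<^sup>2)"
      using d(2,3) by (intro sum.mono_neutral_right) auto
    then show ?thesis using d(1) by (simp add: L2_set_def sum.reindex)
  qed
  then have "cmean (\<lambda>t. cmod (analytic_poly D (\<lambda>m. slice c m s) t))
      \<le> L2_set (\<lambda>k. cmod (slice c (d k) s)) A" for s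
    using cmean_analytic_poly_le_L2[of D "\<lambda>m. slice c m s"] by simp
  moreover have "L1_norm_T2 (trig_poly2 c)
      = cmean (\<lambda>s. cmean (\<lambda>t. cmod (analytic_poly D (\<lambda>m. slice c m s) t)))"
    using D by (rule L1_norm_T2_shear)
  ultimately show ?thesis
    by (simp only:) (intro cmean_mono continuous_on_cmean_analytic_poly_slice, auto intro!: continuous_intros)
qed

text \<open>The inequality of Paley for each fixed \<open>s\<close>, with the slices as
  coefficients; its constant does not depend on \<open>s\<close>, so it survives the mean.\<close>

lemma L1_norm_T2_ge_slices:
  assumes "lacunary d"
  obtains \<gamma> where "\<gamma> > 0"
    "\<And>n D c. (\<And>n. c n \<noteq> 0 \<Longrightarrow> fst n + snd n \<le> D) \<Longrightarrow> (\<And>k. k \<in> {1..n} \<Longrightarrow> d k \<le> D) \<Longrightarrow>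
      \<gamma> * cmean (\<lambda>s. L2_set (\<lambda>k. cmod (slice c (d k) s)) {1..n}) \<le> L1_norm_T2 (trig_poly2 c)"
proof -
  obtain \<gamma> where \<gamma>: "\<gamma> > 0"
    "\<And>n D a. (\<And>k. k \<in> {1..n} \<Longrightarrow> d k \<le> D) \<Longrightarrow>
      \<gamma> * L2_set (\<lambda>k. cmod (a (d k))) {1..n} \<le> cmean (\<lambda>x. cmod (analytic_poly D a x))"
    using paley[OF assms] by blast
  show ?thesis
  proof (rule that[OF \<gamma>(1)])
    fix n D and c :: "nat \<times> nat \<Rightarrow> complex"
    assume D: "\<And>n. c n \<noteq> 0 \<Longrightarrow> fst n + snd n \<le> D" and dD: "\<And>k. k \<in> {1..n} \<Longrightarrow> d k \<le> D"
    have shear: "L1_norm_T2 (trig_poly2 c)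
        = cmean (\<lambda>s. cmean (\<lambda>t. cmod (analytic_poly D (\<lambda>m. slice c m s) t)))"
      using D by (rule L1_norm_T2_shear)
    have "\<gamma> * cmean (\<lambda>s. L2_set (\<lambda>k. cmod (slice c (d k) s)) {1..n})
        = cmean (\<lambda>s. \<gamma> * L2_set (\<lambda>k. cmod (slice c (d k) s)) {1..n})"
      by (simp add: cmean_mult)
    also have "\<dots> \<le> L1_norm_T2 (trig_poly2 c)"
      unfolding shear
      by (intro cmean_mono continuous_on_cmean_analytic_poly_slice \<gamma>(2)[of n D "\<lambda>m. slice c m _"] dD)
        (auto intro!: continuous_intros)
    finally show "\<gamma> * cmean (\<lambda>s. L2_set (\<lambda>k. cmod (slice c (d k) s)) {1..n})
        \<le> L1_norm_T2 (trig_poly2 c)" .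
  qed
qed

section \<open>Action of the multiplier on slices\<close>

definition diagonal_lattice_set :: "(nat \<Rightarrow> nat) \<Rightarrow> (nat \<Rightarrow> nat) \<Rightarrow> (nat \<times> nat) set" where
  "diagonal_lattice_set d N = (\<Union>k\<in>{1..}. {(n1,n2). n1 + n2 = d k \<and> N k dvd n1})"

definition restrict_coeffs :: "(nat \<times> nat) set \<Rightarrow> (nat \<times> nat \<Rightarrow> complex) \<Rightarrow> nat \<times> nat \<Rightarrow> complex" where
  "restrict_coeffs E c = (\<lambda>n. if n \<in> E then c n else 0)"

text \<open>Injectivity of \<open>d\<close> ensures that the antidiagonal of \<open>d k\<close>
  meets only the \<open>k\<close>-th piece of the set, where the condition on \<open>n1\<close> is
  divisibility by \<open>N k\<close>; the grid average selects just these frequencies.\<close>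

lemma slice_restrict_diagonal:
  assumes "inj_on d {1..}" "k \<ge> 1" "N k > 0"
  shows "slice (restrict_coeffs (diagonal_lattice_set d N) c) (d k) s = grid_mean (N k) (slice c (d k)) s"
proof -
  have mem: "(i, d k - i) \<in> diagonal_lattice_set d N \<longleftrightarrow> N k dvd i" if "i \<le> d k" for i
  proof -
    have "d j = d k \<longleftrightarrow> j = k" if "j \<ge> 1" for j
      using assms that by (auto dest: inj_onD)
    then show ?thesis using that assms(2)
      unfolding diagonal_lattice_set_def by fastforce
  qed
  have "grid_mean (N k) (slice c (d k)) s
      = grid_mean (N k) (\<lambda>s. \<Sum>i\<le>d k. c (i, d k - i) * cis (of_int (int i) * s)) s"
    by (simp add: slice_def[abs_def])
  also have "\<dots> = (\<Sum>i\<le>d k. c (i, d k - i) * (if N k dvd i then cis (real i * s) else 0))"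
    unfolding grid_mean_sum grid_mean_mult grid_mean_cis[OF assms(3)] by (simp cong: if_cong)
  also have "\<dots> = slice (restrict_coeffs (diagonal_lattice_set d N) c) (d k) s"
    unfolding slice_def restrict_coeffs_def by (intro sum.cong refl) (auto simp: mem)
  finally show ?thesis ..
qed

lemma slice_restrict_off_diagonal:
  assumes "m \<notin> d ` {1..}"
  shows "slice (restrict_coeffs (diagonal_lattice_set d N) c) m s = 0"
  unfolding slice_def
proof (rule sum.neutral, intro ballI)
  fix i assume "i \<in> {..m}"
  then have "(i, m - i) \<notin> diagonal_lattice_set d N"
    using assms by (auto simp: diagonal_lattice_set_def image_iff)
  then show "restrict_coeffs (diagonal_lattice_set d N) c (i, m - i) * cis (real i * s) = 0"
    by (simp add: restrict_coeffs_def)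
qed

section \<open>Elementary growth of lacunary sequences\<close>

lemma lacunary_less:
  assumes "lacunary d" "1 \<le> j" "j < k" shows "d j < d k"
proof -
  have "d i < d (Suc i)" if "i \<ge> 1" for i
  proof -
    obtain q where q: "q > 1" "\<forall>k\<ge>1. real (d (k+1)) \<ge> q * real (d k)"
      using assms(1) unfolding lacunary_def by blast
    have "d i > 0" "real (d (i+1)) \<ge> q * real (d i)"
      using assms(1) q(2) that unfolding lacunary_def by auto
    moreover have "1 * real (d i) < q * real (d i)"
      using \<open>q > 1\<close> \<open>d i > 0\<close> by (intro mult_strict_right_mono) auto
    ultimately have "real (d i) < real (d (i+1))" by linarith
    then show ?thesis by simp
  qed
  then show ?thesis using assms(3,2)
    by (induction k) (auto simp: less_Suc_eq intro: less_trans)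
qed

lemma lacunary_inj: "lacunary d \<Longrightarrow> inj_on d {1..}"
  by (rule linorder_inj_onI) (auto dest: lacunary_less[of d])

text \<open>Guarantees that a finitely supported coefficient family meets only finitely many of the
  antidiagonals, with an explicit bound on the index.\<close>

lemma lacunary_ge: "lacunary d \<Longrightarrow> k \<ge> 1 \<Longrightarrow> d k \<ge> k"
proof (induction k)
  case (Suc k)
  show ?case
  proof (cases "k = 0")
    case True
    then show ?thesis using Suc.prems by (auto simp: lacunary_def Suc_le_eq)
  next
    case False
    then show ?thesis using Suc.IH[OF Suc.prems(1)] lacunary_less[of d k "Suc k"] Suc.prems by auto
  qed
qed simp

section \<open>Sufficiency of the growth condition\<close>

text \<open>If \<open>N k\<close> were zero, divisibility would force \<open>N (k+1) = 0\<close>,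
  against strict growth; and a strictly increasing divisor chain at least doubles at each
  step.\<close>

lemma divisor_chain_growth:
  fixes N :: "nat \<Rightarrow> nat"
  assumes dvd: "\<And>k. k \<ge> 1 \<Longrightarrow> N k dvd N (k+1)" and less: "\<And>k. k \<ge> 1 \<Longrightarrow> N k < N (k+1)" and k: "k \<ge> 1"
  shows "N k > 0" "N k dvd N (k + i)" "2 ^ i * N k \<le> N (k + i)"
proof -
  show pos: "N k > 0"
    using dvd[OF k] less[OF k] by (cases "N k = 0") auto
  show "N k dvd N (k + i)"
  proof (induction i)
    case (Suc i)
    then show ?case using dvd[of "k + i"] k by (auto intro: dvd_trans)
  qed simp
  show "2 ^ i * N k \<le> N (k + i)"
  proof (induction i)
    case (Suc i)
    obtain m where m: "N (k + i + 1) = N (k + i) * m" using dvd[of "k + i"] k by (auto elim: dvdE)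
    have "m \<noteq> 0" "m \<noteq> 1" using less[of "k + i"] k m by (auto intro: gr0I)
    have "2 ^ Suc i * N k \<le> N (k + i) * 2" using Suc by simp
    also have "\<dots> \<le> N (k + i) * m"
      using \<open>m \<noteq> 0\<close> \<open>m \<noteq> 1\<close> by (intro mult_left_mono) auto
    finally show ?case using m by simp
  qed simp
qed

text \<open>Indices within one class advance by \<open>p\<close>, the spacing at which the degree
  condition of the square function inequality will hold.\<close>

lemma L2_set_residue_classes:
  fixes g :: "nat \<Rightarrow> real"
  shows "L2_set (\<lambda>r. L2_set (\<lambda>i. g (1 + r + i * p)) {..<n}) {..<p} = L2_set g {1..n * p}"
proof -
  have "(\<Sum>k=1..n * p. (g k)\<^sup>2) = (\<Sum>k<n * p. (g (Suc k))\<^sup>2)"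
    by (simp add: sum.atLeast1_atMost_eq)
  also have "\<dots> = (\<Sum>i<n. sum (\<lambda>k. (g (Suc k))\<^sup>2) {i * p..<i * p + p})"
    by (rule sum.nat_group[symmetric])
  also have "\<dots> = (\<Sum>i<n. \<Sum>r<p. (g (1 + r + i * p))\<^sup>2)"
  proof (rule sum.cong[OF refl])
    fix i
    show "sum (\<lambda>k. (g (Suc k))\<^sup>2) {i * p..<i * p + p} = (\<Sum>r<p. (g (1 + r + i * p))\<^sup>2)"
      using sum.shift_bounds_nat_ivl[of "\<lambda>k. (g (Suc k))\<^sup>2" 0 "i * p" p]
      by (simp add: lessThan_atLeast0 add.commute)
  qed
  also have "\<dots> = (\<Sum>r<p. \<Sum>i<n. (g (1 + r + i * p))\<^sup>2)" by (rule sum.swap)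
  finally show ?thesis by (simp add: L2_set_def sum_nonneg)
qed

lemma idempotent_ring_if_bounded:
  fixes d N :: "nat \<Rightarrow> nat"
  assumes lac: "lacunary d"
    and dvd: "\<And>k. k \<ge> 1 \<Longrightarrow> N k dvd N (k+1)" and less: "\<And>k. k \<ge> 1 \<Longrightarrow> N k < N (k+1)"
    and bd: "\<And>k. k \<ge> 1 \<Longrightarrow> real (d k) \<le> C * real (N (k+a))"
  shows "idempotent_ring_H1 (diagonal_lattice_set d N)"
proof -
  have growth: "N k > 0" "2 ^ i * N k \<le> N (k + i)" if "k \<ge> 1" for k i
    using divisor_chain_growth(1,3)[of N k] dvd less that by blast+
  obtain b :: nat where b: "C < 2 ^ b" using real_arch_pow[of 2 C] by auto
  \<comment> \<open>Doublings of \<open>N\<close> absorb the constant \<open>C\<close>, which gives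
    \<open>d k \<le> N (k + p)\<close>; the summand 1 keeps \<open>p\<close> positive.\<close>
  define p where "p = a + b + 1"
  have dN: "d k \<le> N (k + p)" if "k \<ge> 1" for k
  proof -
    have "real (d k) \<le> C * real (N (k + a))" using bd that by simp
    also have "\<dots> \<le> 2 ^ b * real (N (k + a))" using b by (intro mult_right_mono) auto
    also have "\<dots> \<le> 2 ^ (b + 1) * real (N (k + a))" by (intro mult_right_mono) auto
    also have "\<dots> \<le> real (N (k + p))"
    proof -
      have "real (2 ^ (b + 1) * N (k + a)) \<le> real (N (k + a + (b + 1)))"
        unfolding of_nat_le_iff by (intro growth(2)) (use that in auto)
      then show ?thesis by (simp add: p_def add_ac)
    qed
    finally show ?thesis by simp
  qed
  have Nmono: "N j \<le> N k" if "1 \<le> j" "j \<le> k" for j k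
  proof -
    have "1 * N j \<le> 2 ^ (k - j) * N j" by (intro mult_right_mono) auto
    also have "\<dots> \<le> N k" using growth(2)[of j "k - j"] that by simp
    finally show ?thesis by simp
  qed
  obtain \<gamma> where \<gamma>: "\<gamma> > 0"
    "\<And>n D c. (\<And>n. c n \<noteq> 0 \<Longrightarrow> fst n + snd n \<le> D) \<Longrightarrow> (\<And>k. k \<in> {1..n} \<Longrightarrow> d k \<le> D) \<Longrightarrow>
      \<gamma> * cmean (\<lambda>s. L2_set (\<lambda>k. cmod (slice c (d k) s)) {1..n}) \<le> L1_norm_T2 (trig_poly2 c)"
    using L1_norm_T2_ge_slices[OF lac] by blast
  show ?thesis unfolding idempotent_ring_H1_def
  proof (intro exI allI impI)
    fix c :: "nat \<times> nat \<Rightarrow> complex" assume fin: "finite {n. c n \<noteq> 0}"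
    define c' where "c' = restrict_coeffs (diagonal_lattice_set d N) c"
    obtain D0 where D0: "\<And>n. c n \<noteq> 0 \<Longrightarrow> fst n + snd n \<le> D0"
    proof -
      have "finite ((\<lambda>n. fst n + snd n) ` {n. c n \<noteq> 0})" using fin by simp
      then obtain D0 where "\<forall>x\<in>(\<lambda>n. fst n + snd n) ` {n. c n \<noteq> 0}. x \<le> D0"
        unfolding finite_nat_set_iff_bounded_le by blast
      then show ?thesis by (intro that[of D0]) auto
    qed
    \<comment> \<open>Since \<open>d k \<ge> k\<close>, every index beyond \<open>n * p\<close> has
      \<open>d k > D0\<close>, so the indices up to \<open>n * p\<close> catch all nonzero slices of
      \<open>c'\<close>. Being a multiple of \<open>p\<close>, this range splits into residue
      classes of equal size.\<close>
    define n where "n = D0 + 1"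
    define D where "D = D0 + d (n * p)"
    have D: "fst m + snd m \<le> D" if "c m \<noteq> 0" for m using D0[OF that] by (simp add: D_def)
    have D': "fst m + snd m \<le> D" if "c' m \<noteq> 0" for m
      using D that by (auto simp: c'_def restrict_coeffs_def split: if_splits)
    have dD: "d k \<le> D" if "k \<in> {1..n * p}" for k
      using lacunary_less[OF lac, of k "n * p"] that
      by (cases "k = n * p") (auto simp: D_def intro: less_imp_le_nat trans_le_add2)
    have inj: "inj_on d {1..n * p}" using lacunary_inj[OF lac] by (rule inj_on_subset) auto
    have off: "slice c' m s = 0" if "m \<notin> d ` {1..n * p}" for m s
    proof (cases "m \<in> d ` {1..}")
      case False
      then show ?thesis unfolding c'_def by (rule slice_restrict_off_diagonal)
    next
      case True
      then obtain k where k: "m = d k" "k \<ge> 1" by auto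
      then have "k > n * p" using that by (auto simp: image_iff not_le[symmetric])
      moreover have "n * 1 \<le> n * p" by (intro mult_left_mono) (auto simp: p_def)
      ultimately have "m > D0" using lacunary_ge[OF lac k(2)] k by (simp add: n_def)
      have "c' (i, m - i) = 0" if "i \<le> m" for i
      proof (rule ccontr)
        assume "c' (i, m - i) \<noteq> 0"
        then have "c (i, m - i) \<noteq> 0" by (auto simp: c'_def restrict_coeffs_def split: if_splits)
        from D0[OF this] show False using that \<open>m > D0\<close> by simp
      qed
      then show ?thesis by (simp add: slice_def)
    qed
    define g where "g k s = cmod (slice c (d k) s)" for k s
    define h where "h k s = cmod (slice c' (d k) s)" for k s
    have cg: "continuous_on UNIV (g k)" "continuous_on UNIV (h k)" for k
      unfolding g_def h_def by (intro continuous_intros)+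
    have cls: "cmean (\<lambda>s. L2_set (\<lambda>i. h (1 + r + i * p) s) {..<n}) \<le> 6 * cmean (\<lambda>s. L2_set (\<lambda>k. g k s) {1..n * p})"
      if "r < p" for r
    proof -
      have "h (1 + r + i * p) s = cmod (grid_mean (N (1 + r + i * p)) (slice c (d (1 + r + i * p))) s)" for i s
        unfolding h_def c'_def
        by (subst slice_restrict_diagonal) (use lacunary_inj[OF lac] growth(1) in auto)
      then have "cmean (\<lambda>s. L2_set (\<lambda>i. h (1 + r + i * p) s) {..<n})
        = cmean (\<lambda>s. L2_set (\<lambda>i. cmod (grid_mean (N (1 + r + i * p)) (slice c (d (1 + r + i * p))) s)) {..<n})"
        by presburger
      also have "\<dots> \<le> 6 * cmean (\<lambda>s. L2_set (\<lambda>i. cmod (slice c (d (1 + r + i * p)) s)) {..<n})"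
      proof (rule cmean_L2_set_grid_mean_le)
        show "mono (\<lambda>i. N (1 + r + i * p))"
          by (intro monoI Nmono) (auto intro: mult_right_mono)
        show "bandlimited (N (1 + r + Suc i * p)) (slice c (d (1 + r + i * p)))" for i
          using dN[of "1 + r + i * p"] by (intro bandlimited_slice) (simp add: add_ac)
      qed (use growth(1) in auto)
      also have "cmean (\<lambda>s. L2_set (\<lambda>i. cmod (slice c (d (1 + r + i * p)) s)) {..<n})
          \<le> cmean (\<lambda>s. L2_set (\<lambda>k. g k s) {1..n * p})"
      proof (rule cmean_mono)
        fix s
        show "L2_set (\<lambda>i. cmod (slice c (d (1 + r + i * p)) s)) {..<n} \<le> L2_set (\<lambda>k. g k s) {1..n * p}"
          unfolding g_def L2_set_residue_classes[of "\<lambda>k. cmod (slice c (d k) s)" p n, symmetric]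
          using that
          by (intro member_le_L2_set[of _ r "\<lambda>r. L2_set (\<lambda>i. cmod (slice c (d (1 + r + i * p)) s)) {..<n}"]) auto
      qed (intro continuous_intros cg)+
      finally show ?thesis by simp
    qed
    have "L1_norm_T2 (trig_poly2 c') \<le> cmean (\<lambda>s. L2_set (\<lambda>k. h k s) {1..n * p})"
      unfolding h_def using dD by (intro L1_norm_T2_le_slices[of c' D] D' inj off) auto
    also have "\<dots> \<le> cmean (\<lambda>s. \<Sum>r<p. L2_set (\<lambda>i. h (1 + r + i * p) s) {..<n})"
      unfolding L2_set_residue_classes[symmetric]
      by (intro cmean_mono continuous_intros cg L2_set_le_sum) auto
    also have "\<dots> = (\<Sum>r<p. cmean (\<lambda>s. L2_set (\<lambda>i. h (1 + r + i * p) s) {..<n}))"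
      by (rule cmean_sum) (auto intro!: continuous_intros cg)
    also have "\<dots> \<le> (\<Sum>r<p. 6 * cmean (\<lambda>s. L2_set (\<lambda>k. g k s) {1..n * p}))"
      by (intro sum_mono cls) auto
    also have "\<dots> = 6 * real p / \<gamma> * (\<gamma> * cmean (\<lambda>s. L2_set (\<lambda>k. g k s) {1..n * p}))"
      using \<gamma>(1) by simp
    also have "\<dots> \<le> 6 * real p / \<gamma> * L1_norm_T2 (trig_poly2 c)"
      unfolding g_def using \<gamma>(1) by (intro mult_left_mono \<gamma>(2)[of c D] D dD) auto
    finally show "L1_norm_T2 (trig_poly2 (\<lambda>n. if n \<in> diagonal_lattice_set d N then c n else 0))
        \<le> 6 * real p / \<gamma> * L1_norm_T2 (trig_poly2 c)"
      by (simp add: c'_def restrict_coeffs_def)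
  qed
qed

section \<open>Necessity of the growth condition\<close>

lemma fejer_zero: "fejer n 0 = real n"
  by (simp add: fejer_def power2_eq_square)

lemma fejer_2pi: "fejer n (2 * pi) = real n"
proof -
  have "cis (real j * (2 * pi)) = 1" for j using cis_int_periodic[of "int j" 0] by simp
  then show ?thesis by (simp add: fejer_def power2_eq_square)
qed

lemma grid_mean_fejer_nonneg [simp]: "0 \<le> grid_mean N (fejer L) x"
  by (simp add: grid_mean_def sum_nonneg)

text \<open>At a point of the grid of order \<open>N\<close> some translate lands on
  \<open>0\<close> or \<open>2*pi\<close>, where the kernel takes its peak value \<open>L\<close>;
  the other translates are nonnegative.\<close>

lemma grid_mean_fejer_peak:
  assumes "i < N"
  shows "real L / real N \<le> grid_mean N (fejer L) (2 * pi * real i / real N)"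
proof -
  define j where "j = (if i = 0 then 0 else N - i)"
  have j: "j < N" using assms by (auto simp: j_def)
  have "fejer L (2 * pi * real i / real N + 2 * pi * real j / real N) = real L"
  proof (cases "i = 0")
    case False
    then have "2 * pi * real i / real N + 2 * pi * real j / real N = 2 * pi"
      using assms by (simp add: j_def field_simps of_nat_diff)
    then show ?thesis by (simp add: fejer_2pi)
  qed (simp add: j_def fejer_zero)
  then have "real L \<le> (\<Sum>l<N. fejer L (2 * pi * real i / real N + 2 * pi * real l / real N))"
    using member_le_sum[of j "{..<N}" "\<lambda>l. fejer L (2 * pi * real i / real N + 2 * pi * real l / real N)"] j
    by simp
  then show ?thesis using assms by (simp add: grid_mean_def field_simps)
qed

lemma bandlimited_grid_mean_fejer:
  assumes "L > 0" "N > 0"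
  shows "bandlimited L (\<lambda>x. complex_of_real (grid_mean N (fejer L) x))"
proof -
  have "complex_of_real (grid_mean N (fejer L) x) = (\<Sum>m\<in>{-int L..int L}.
      (of_real (fejer_coeff L m) * (if int N dvd m then 1 else 0)) * cis (of_int m * x))" for x
  proof -
    have "complex_of_real (grid_mean N (fejer L) x) = grid_mean N (\<lambda>x. complex_of_real (fejer L x)) x"
      by (simp add: grid_mean_def scaleR_conv_of_real)
    also have "\<dots> = (\<Sum>m\<in>{-int L..int L}. of_real (fejer_coeff L m) *
        (if int N dvd m then cis (of_int m * x) else 0))"
      unfolding fejer_expand[OF assms(1)] by (simp add: grid_mean_sum grid_mean_mult grid_mean_cis assms)
    finally show ?thesis by (auto intro!: sum.cong)
  qed
  then show ?thesis unfolding bandlimited_def by (intro exI ext)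
qed

text \<open>Each refinement of the grid from \<open>N (k + i)\<close> to
  \<open>N (k + i + 1)\<close> points at least doubles it, so at least half of the points are new.
  There the kernel averaged at the new level is at least \<open>L / N (k + i + 1)\<close>, so every
  level contributes at least \<open>L / 2\<close> on its own points.\<close>

lemma sum_L2_set_grid_mean_fejer_ge:
  fixes N :: "nat \<Rightarrow> nat"
  assumes dvd: "\<And>k. k \<ge> 1 \<Longrightarrow> N k dvd N (k+1)" and less: "\<And>k. k \<ge> 1 \<Longrightarrow> N k < N (k+1)"
    and k: "k \<ge> 1" and i: "i \<le> a"
  defines "L \<equiv> N (k + a)"
  shows "real i * (real L / 2) \<le> (\<Sum>l\<in>{l. l < L \<and> L div N (k + i) dvd l}.
    L2_set (\<lambda>j. grid_mean (N j) (fejer L) (2 * pi * real l / real L)) {k..k + a})"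
  using i
proof (induction i)
  case 0
  then show ?case by (auto intro: sum_nonneg)
next
  case (Suc i)
  have growth: "N k > 0" "N k dvd N (k + i)" "2 ^ i * N k \<le> N (k + i)" if "k \<ge> 1" for k i
    using divisor_chain_growth[of N k] dvd less that by blast+
  \<comment> \<open>\<open>W i\<close> picks out, among the \<open>L\<close> grid points, those of
    the coarser grid of order \<open>N (k + i)\<close>.\<close>
  define W where "W i = {l. l < L \<and> L div N (k + i) dvd l}" for i
  define G where "G l = L2_set (\<lambda>j. grid_mean (N j) (fejer L) (2 * pi * real l / real L)) {k..k + a}" for l
  have L0: "L > 0" unfolding L_def using growth(1)[of "k + a"] k by simp
  have pos: "N (k + i) > 0" for i using growth(1)[of "k + i"] k by simp
  have NL: "N (k + i) dvd L" if "i \<le> a" for i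
    unfolding L_def using growth(2)[of "k + i" "a - i"] k that by simp
  have W_eq: "W i = (\<lambda>t. t * (L div N (k + i))) ` {..<N (k + i)}" if "i \<le> a" for i
  proof -
    define Q where "Q = L div N (k + i)"
    have LQ: "L = N (k + i) * Q" using NL[OF that] by (simp add: Q_def)
    then have Q0: "Q > 0" using L0 by (auto intro: gr0I)
    show ?thesis unfolding W_def Q_def[symmetric]
    proof (intro equalityI subsetI)
      fix l assume "l \<in> {l. l < L \<and> Q dvd l}"
      then have "l < L" "Q dvd l" by auto
      then obtain t where t: "l = t * Q" "l < L" by (metis dvdE mult.commute)
      then have "t < N (k + i)" using LQ by simp
      then show "l \<in> (\<lambda>t. t * Q) ` {..<N (k + i)}" using t by auto
    qed (use LQ Q0 in auto)
  qed
  have card: "card (W i) = N (k + i)" if "i \<le> a" for i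
  proof -
    have "L div N (k + i) > 0"
      using NL[OF that] L0 pos by (simp add: dvd_imp_le div_greater_zero_iff)
    then show ?thesis unfolding W_eq[OF that] by (subst card_image) (auto simp: inj_on_def)
  qed
  have finW: "finite (W i)" for i unfolding W_def by simp
  have sub: "W i \<subseteq> W (Suc i)"
  proof -
    obtain m where m: "N (k + Suc i) = N (k + i) * m" using dvd[of "k + i"] k by (auto elim: dvdE)
    obtain Q where Q: "L = N (k + Suc i) * Q" using NL[of "Suc i"] Suc.prems by (auto elim: dvdE)
    have "m > 0" using m pos[of "Suc i"] by (auto intro: gr0I)
    have "L div N (k + Suc i) = Q" using Q pos[of "Suc i"] by simp
    moreover have "L div N (k + i) = m * Q" using Q m pos[of i] by (simp add: mult.assoc)
    ultimately show ?thesis unfolding W_def by (auto intro: dvd_trans)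
  qed
  have "card (W (Suc i) - W i) = N (k + Suc i) - N (k + i)"
    using card[of "Suc i"] card[of i] Suc.prems sub finW by (simp add: card_Diff_subset)
  moreover have "2 * N (k + i) \<le> N (k + Suc i)" using growth(3)[of "k + i" 1] k by simp
  ultimately have cd: "real (N (k + Suc i)) / 2 \<le> real (card (W (Suc i) - W i))" by linarith
  have peak: "real L / real (N (k + Suc i)) \<le> G l" if "l \<in> W (Suc i)" for l
  proof -
    have "l \<in> (\<lambda>t. t * (L div N (k + Suc i))) ` {..<N (k + Suc i)}"
      using that W_eq[OF Suc.prems] by simp
    then obtain t where t: "l = t * (L div N (k + Suc i))" "t < N (k + Suc i)" by auto
    have e: "real L = real (N (k + Suc i)) * real (L div N (k + Suc i))"
      using NL[OF Suc.prems] by (simp flip: of_nat_mult)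
    have "real (L div N (k + Suc i)) \<noteq> 0"
    proof
      assume "real (L div N (k + Suc i)) = 0"
      with e have "real L = 0" by (simp only: mult_zero_right)
      then show False using L0 by simp
    qed
    with e have "2 * pi * real l / real L = 2 * pi * real t / real (N (k + Suc i))"
      unfolding t by (simp add: field_simps)
    then have "real L / real (N (k + Suc i)) \<le> grid_mean (N (k + Suc i)) (fejer L) (2 * pi * real l / real L)"
      using grid_mean_fejer_peak[OF t(2), of L] by simp
    also have "\<dots> \<le> G l" unfolding G_def
      using Suc.prems by (intro member_le_L2_set[of _ "k + Suc i" "\<lambda>j. grid_mean (N j) (fejer L) (2 * pi * real l / real L)"]) auto
    finally show ?thesis .
  qed
  have "real L / 2 = real (N (k + Suc i)) / 2 * (real L / real (N (k + Suc i)))"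
    using pos[of "Suc i"] by simp
  also have "\<dots> \<le> real (card (W (Suc i) - W i)) * (real L / real (N (k + Suc i)))"
    using cd by (intro mult_right_mono) auto
  also have "\<dots> \<le> sum G (W (Suc i) - W i)"
    using peak by (intro sum_bounded_below) auto
  finally have "real L / 2 \<le> sum G (W (Suc i) - W i)" .
  moreover have "real i * (real L / 2) \<le> sum G (W i)"
    using Suc unfolding G_def W_def by simp
  moreover have "sum G (W (Suc i)) = sum G (W (Suc i) - W i) + sum G (W i)"
    using sum.subset_diff[OF sub finW] .
  ultimately have "real (Suc i) * (real L / 2) \<le> sum G (W (Suc i))" by (simp add: algebra_simps)
  then show ?case unfolding G_def W_def .
qed

text \<open>The last level of the preceding lemma covers the whole grid of order \<open>L\<close>,
  and the sampling inequality turns the lower bound \<open>a / 2\<close> for the grid average into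
  one for the mean, at the cost of the factor 5.\<close>

lemma cmean_L2_set_grid_mean_fejer_ge:
  fixes N :: "nat \<Rightarrow> nat" and a :: nat
  assumes dvd: "\<And>k. k \<ge> 1 \<Longrightarrow> N k dvd N (k+1)" and less: "\<And>k. k \<ge> 1 \<Longrightarrow> N k < N (k+1)"
    and k: "k \<ge> 1"
  defines "L \<equiv> N (k + a)"
  shows "real a / 10 \<le> cmean (\<lambda>x. L2_set (\<lambda>j. grid_mean (N j) (fejer L) x) {k..k + a})"
proof -
  have pos: "N j > 0" if "j \<ge> 1" for j
    using divisor_chain_growth(1)[of N j] dvd less that by blast
  have L0: "L > 0" unfolding L_def using pos[of "k + a"] k by simp
  define G where "G x = L2_set (\<lambda>j. grid_mean (N j) (fejer L) x) {k..k + a}" for x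
  have G: "G x = L2_set (\<lambda>j. cmod (complex_of_real (grid_mean (N j) (fejer L) x))) {k..k + a}" for x
    by (simp add: G_def)
  have "{l. l < L \<and> L div N (k + a) dvd l} = {..<L}" using L0 by (auto simp: L_def)
  then have "real a * (real L / 2) \<le> (\<Sum>l<L. G (2 * pi * real l / real L))"
    using sum_L2_set_grid_mean_fejer_ge[of N k a a] dvd less k
    by (simp add: G_def L_def)
  then have "real a / 2 \<le> grid_mean L G 0"
    using L0 by (simp add: grid_mean_def field_simps)
  also have "\<dots> \<le> 5 * cmean G"
    unfolding G[abs_def]
    using L0 k pos by (intro grid_mean_L2_set_le bandlimited_grid_mean_fejer) auto
  finally show ?thesis by (simp add: G_def[abs_def])
qed

text \<open>Modulation by \<open>L\<close> moves the frequencies of the kernel into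
  \<open>0..2*L\<close>. They must fit on an antidiagonal with \<open>n1 + n2 = d\<close>, which
  explains the threshold \<open>2 * N (k + a)\<close> below.\<close>

lemma sum_fejer_coeff_shift:
  assumes "L > 0" "2 * L \<le> d"
  shows "(\<Sum>i\<le>d. of_real (fejer_coeff L (int i - int L)) * cis (real i * s)) = cis (real L * s) * of_real (fejer L s)"
proof -
  have "(\<Sum>i\<le>d. of_real (fejer_coeff L (int i - int L)) * cis (real i * s))
      = (\<Sum>i\<le>2*L. of_real (fejer_coeff L (int i - int L)) * cis (real i * s))"
    using assms by (intro sum.mono_neutral_right) (auto simp: fejer_coeff_def field_simps)
  also have "\<dots> = (\<Sum>m\<in>{-int L..int L}. of_real (fejer_coeff L m) * cis (real_of_int (m + int L) * s))"
    by (rule sum.reindex_bij_witness[of _ "\<lambda>m. nat (m + int L)" "\<lambda>i. int i - int L"]) auto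
  also have "\<dots> = cis (real L * s) * of_real (fejer L s)"
    unfolding fejer_expand[OF assms(1)] sum_distrib_left
    by (intro sum.cong refl) (simp add: distrib_right mult.left_commute[of "cis _"] cis_mult add.commute)
  finally show ?thesis .
qed

text \<open>The modulation is invariant under the translations of the grid because \<open>N\<close>
  divides \<open>L\<close>.\<close>

lemma grid_mean_cis_mult:
  assumes "N > 0" "N dvd L"
  shows "grid_mean N (\<lambda>x. cis (real L * x) * of_real (f x)) x = cis (real L * x) * of_real (grid_mean N f x)"
proof -
  obtain m where m: "L = N * m" using assms by blast
  have "cis (real L * (x + 2*pi*real l/real N)) = cis (real L * x)" for l
  proof -
    have "cis (real L * (x + 2*pi*real l/real N)) = cis (real L * x) * cis (2 * pi * of_int (int (m * l)))"
      unfolding cis_mult using assms m by (intro arg_cong[where f=cis]) (simp add: field_simps)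
    then show ?thesis using cis_multiple_2pi[of "of_int (int (m * l))"] by simp
  qed
  then show ?thesis by (simp add: grid_mean_def scaleR_conv_of_real sum_distrib_left mult_ac)
qed

lemma bounded_if_idempotent_ring:
  fixes d N :: "nat \<Rightarrow> nat"
  assumes lac: "lacunary d"
    and dvd: "\<And>k. k \<ge> 1 \<Longrightarrow> N k dvd N (k+1)" and less: "\<And>k. k \<ge> 1 \<Longrightarrow> N k < N (k+1)"
    and ring: "idempotent_ring_H1 (diagonal_lattice_set d N)"
  shows "\<exists>a. \<forall>k\<ge>1. d k \<le> 2 * N (k + a)"
proof -
  have growth: "N k > 0" "N k dvd N (k + i)" if "k \<ge> 1" for k i
    using divisor_chain_growth(1,2)[of N k] dvd less that by blast+
  obtain K where K: "\<And>c. finite {n. c n \<noteq> 0} \<Longrightarrow>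
      L1_norm_T2 (trig_poly2 (restrict_coeffs (diagonal_lattice_set d N) c)) \<le> K * L1_norm_T2 (trig_poly2 c)"
    using ring unfolding idempotent_ring_H1_def restrict_coeffs_def by blast
  obtain \<gamma> where \<gamma>: "\<gamma> > 0"
    "\<And>n D c. (\<And>n. c n \<noteq> 0 \<Longrightarrow> fst n + snd n \<le> D) \<Longrightarrow> (\<And>k. k \<in> {1..n} \<Longrightarrow> d k \<le> D) \<Longrightarrow>
      \<gamma> * cmean (\<lambda>s. L2_set (\<lambda>k. cmod (slice c (d k) s)) {1..n}) \<le> L1_norm_T2 (trig_poly2 c)"
    using L1_norm_T2_ge_slices[OF lac] by blast
  \<comment> \<open>Together with \<open>sqrt (a + 1) \<le> 2 * sqrt a\<close>, the choice
    \<open>a > R\<^sup>2 + 1\<close> makes the lower bound, linear in \<open>a\<close>, exceed the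
    upper bound of order \<open>sqrt a\<close>; the factor 20 is \<open>2 * 10\<close>.\<close>
  define R where "R = 20 * \<bar>K\<bar> / \<gamma>"
  obtain a :: nat where a: "R\<^sup>2 + 1 < real a" using reals_Archimedean2 by blast
  have a_big: "\<bar>K\<bar> * sqrt (real (a + 1)) < \<gamma> * (real a / 10)"
  proof -
    have R0: "0 \<le> R" using \<gamma>(1) by (simp add: R_def)
    have a1: "1 \<le> real a" using a zero_le_power2[of R] by linarith
    have "R = sqrt (R\<^sup>2)" using R0 by simp
    also have "\<dots> < sqrt (real a)" using a by (intro real_sqrt_less_mono) linarith
    finally have "R * sqrt (real a) < sqrt (real a) * sqrt (real a)"
      using a1 by (intro mult_strict_right_mono) auto
    then have "R * sqrt (real a) < real a" by simp
    moreover have "sqrt (real (a + 1)) \<le> 2 * sqrt (real a)"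
      using a1 by (intro real_le_lsqrt) (auto simp: power_mult_distrib)
    then have "\<bar>K\<bar> * sqrt (real (a + 1)) \<le> \<bar>K\<bar> * (2 * sqrt (real a))"
      by (intro mult_left_mono) auto
    ultimately show ?thesis using \<gamma>(1) by (simp add: R_def field_simps)
  qed
  show ?thesis
  proof (intro exI[of _ a] allI impI, rule ccontr)
    fix k :: nat assume k: "k \<ge> 1" and "\<not> d k \<le> 2 * N (k + a)"
    define L where "L = N (k + a)"
    define J where "J = {k..k + a}"
    have L0: "L > 0" unfolding L_def using growth(1)[of "k + a"] k by simp
    have dk: "2 * L \<le> d j" if "j \<in> J" for j
    proof -
      have "2 * L \<le> d k" using \<open>\<not> d k \<le> 2 * N (k + a)\<close> by (simp add: L_def)
      also have "\<dots> \<le> d j"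
        using lacunary_less[OF lac, of k j] that k by (cases "j = k") (auto simp: J_def)
      finally show ?thesis .
    qed
    \<comment> \<open>On the chosen antidiagonals the coefficient depends on the first coordinate
      alone, so all \<open>a + 1\<close> of them carry the same modulated kernel.\<close>
    define c where "c = (\<lambda>n. if fst n + snd n \<in> d ` J
      then complex_of_real (fejer_coeff L (int (fst n) - int L)) else 0)"
    define c' where "c' = restrict_coeffs (diagonal_lattice_set d N) c"
    define D where "D = d (k + a)"
    have dD: "d j \<le> D" if "1 \<le> j" "j \<le> k + a" for j
      using lacunary_less[OF lac, of j "k + a"] that by (cases "j = k + a") (auto simp: D_def)
    have D: "fst n + snd n \<le> D" if "c n \<noteq> 0" for n
      using that dD k by (auto simp: c_def J_def split: if_splits)
    have D': "fst n + snd n \<le> D" if "c' n \<noteq> 0" for n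
      using that D by (auto simp: c'_def restrict_coeffs_def split: if_splits)
    have fin: "finite {n. c n \<noteq> 0}"
      by (rule finite_subset[of _ "{..D} \<times> {..D}"]) (use D in \<open>force+\<close>)
    have slice: "slice c (d j) s = cis (real L * s) * of_real (fejer L s)" if "j \<in> J" for j s
    proof -
      have "slice c (d j) s = (\<Sum>i\<le>d j. of_real (fejer_coeff L (int i - int L)) * cis (real i * s))"
        unfolding slice_def c_def using that by (intro sum.cong refl) auto
      then show ?thesis using sum_fejer_coeff_shift[OF L0 dk[OF that]] by simp
    qed
    have off: "slice c m s = 0" if "m \<notin> d ` J" for m s
      using that by (simp add: slice_def c_def)
    have slice': "cmod (slice c' (d j) s) = grid_mean (N j) (fejer L) s" if "j \<in> J" for j s
    proof -
      have j: "j \<ge> 1" "N j > 0" "N j dvd L"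
        using that k growth(1)[of j] growth(2)[of j "k + a - j"] by (auto simp: J_def L_def)
      have "slice c' (d j) s = grid_mean (N j) (slice c (d j)) s"
        unfolding c'_def using j lacunary_inj[OF lac] by (intro slice_restrict_diagonal) auto
      also have "\<dots> = grid_mean (N j) (\<lambda>s. cis (real L * s) * of_real (fejer L s)) s"
        using slice[OF that] by (simp add: grid_mean_def)
      also have "\<dots> = cis (real L * s) * of_real (grid_mean (N j) (fejer L) s)"
        using j by (intro grid_mean_cis_mult) auto
      finally show ?thesis by (simp add: norm_mult)
    qed
    have "L1_norm_T2 (trig_poly2 c) \<le> cmean (\<lambda>s. L2_set (\<lambda>j. cmod (slice c (d j) s)) J)"
    proof (rule L1_norm_T2_le_slices)
      show "inj_on d J" using lacunary_inj[OF lac] k by (rule_tac inj_on_subset) (auto simp: J_def)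
      show "d ` J \<subseteq> {..D}" using dD k by (auto simp: J_def)
    qed (use D off in auto)
    also have "\<dots> = cmean (\<lambda>s. sqrt (real (a + 1)) * fejer L s)"
    proof -
      have "L2_set (\<lambda>j. cmod (slice c (d j) s)) J = L2_set (\<lambda>j. fejer L s) J" for s
        using slice by (intro L2_set_cong) (auto simp: norm_mult)
      then show ?thesis by (simp add: L2_set_constant J_def)
    qed
    also have "\<dots> = sqrt (real (a + 1))"
      using cmean_fejer[OF L0, of 0] by (simp add: cmean_mult)
    finally have up: "L1_norm_T2 (trig_poly2 c) \<le> sqrt (real (a + 1))" .
    have "\<gamma> * (real a / 10) \<le> \<gamma> * cmean (\<lambda>s. L2_set (\<lambda>j. grid_mean (N j) (fejer L) s) J)"
      unfolding L_def J_def using \<gamma>(1) k dvd less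
      by (intro mult_left_mono cmean_L2_set_grid_mean_fejer_ge) auto
    also have "\<dots> = \<gamma> * cmean (\<lambda>s. L2_set (\<lambda>j. cmod (slice c' (d j) s)) J)"
      using slice' by (simp cong: L2_set_cong)
    \<comment> \<open>The lower bound by slices is stated for an initial segment of indices, so
      \<open>J\<close> is enlarged to \<open>{1..k + a}\<close>.\<close>
    also have "\<dots> \<le> \<gamma> * cmean (\<lambda>s. L2_set (\<lambda>j. cmod (slice c' (d j) s)) {1..k + a})"
      using \<gamma>(1) k
      by (intro mult_left_mono cmean_mono continuous_intros)
        (auto simp: L2_set_def J_def intro!: sum_mono2)
    also have "\<dots> \<le> L1_norm_T2 (trig_poly2 c')"
      using D' dD by (intro \<gamma>(2)) auto
    also have "\<dots> \<le> K * L1_norm_T2 (trig_poly2 c)" unfolding c'_def by (rule K[OF fin])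
    also have "\<dots> \<le> \<bar>K\<bar> * L1_norm_T2 (trig_poly2 c)"
    proof (rule mult_right_mono)
      have "L1_norm_T2 (trig_poly2 c) = cmean (\<lambda>s. cmean (\<lambda>t. cmod (analytic_poly D (\<lambda>m. slice c m s) t)))"
        using D by (rule L1_norm_T2_shear)
      also have "\<dots> \<ge> 0"
        by (intro cmean_nonneg continuous_on_cmean_analytic_poly_slice) (auto intro!: continuous_intros)
      finally show "0 \<le> L1_norm_T2 (trig_poly2 c)" .
    qed simp
    also have "\<dots> \<le> \<bar>K\<bar> * sqrt (real (a + 1))" using up by (intro mult_left_mono) auto
    finally show False using a_big by simp
  qed
qed

theorem theorem2p2:
  fixes d N :: "nat \<Rightarrow> nat"
  assumes "lacunary d"
    and "\<And>k. k \<ge> 1 \<Longrightarrow> N k dvd N (k+1)"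
    and "\<And>k. k \<ge> 1 \<Longrightarrow> N k < N (k+1)"
  shows "(\<exists>(a::nat) (C::real). \<forall>k\<ge>1. real (d k) \<le> C * real (N (k+a))) \<longleftrightarrow>
         idempotent_ring_H1 (\<Union>k\<in>{1..}. {(n1,n2). n1 + n2 = d k \<and> N k dvd n1})"
  unfolding diagonal_lattice_set_def[symmetric]
proof
  assume "\<exists>(a::nat) (C::real). \<forall>k\<ge>1. real (d k) \<le> C * real (N (k+a))"
  then obtain a C where "\<And>k. k \<ge> 1 \<Longrightarrow> real (d k) \<le> C * real (N (k+a))" by blast
  with assms show "idempotent_ring_H1 (diagonal_lattice_set d N)"
    by (rule idempotent_ring_if_bounded)
next
  assume "idempotent_ring_H1 (diagonal_lattice_set d N)"
  with assms have "\<exists>a. \<forall>k\<ge>1. d k \<le> 2 * N (k + a)"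
    by (rule bounded_if_idempotent_ring)
  then obtain a where a: "\<forall>k\<ge>1. d k \<le> 2 * N (k + a)" ..
  have "real (d k) \<le> 2 * real (N (k + a))" if "k \<ge> 1" for k
    using a that by (metis of_nat_le_iff of_nat_mult of_nat_numeral)
  then show "\<exists>(a::nat) (C::real). \<forall>k\<ge>1. real (d k) \<le> C * real (N (k+a))" by blast
qed

end
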